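(* Let $(\mu_n)_{n\in\mathbb{N}}$ be an SI-martingale on $\mathbb{R}^d$, and let $\{\eta_t\}_{t\in\Gamma}$ be a family of finite Borel measures on $\mathbb{R}^d$ indexed by a metric space $(\Gamma,d)$. Write $Y_n^t=\int\mu_n\,d\eta_t$. Assume there are positive constants $\alpha,s,\theta,\gamma_0,C$ such that: (H1) for every $\xi>0$ there is $C_\xi<\infty$ such that for all $r>0$, $\Gamma$ can be covered by $\exp(C_\xi r^{-\xi})$ balls of radius $r$; (H2) $\eta_t(B(x,r))\le C r^s$ for all $x\in\mathbb{R}^d$, $t\in\Gamma$, $0<r<1$; (H3) almost surely, $\mu_n(x)\le C2^{\alpha n}$ for all $n\in\mathbb{N}$ and $x\in\mathbb{R}^d$; (H4) almost surely there is a random integer $N_0$ such that $$\sup_{t,u\in\Gamma,\,t\neq u,\,n\ge N_0}\frac{|Y_n^t-Y_n^u|}{2^{\theta n}d(t,u)^{\gamma_0}}\le C.$$ Suppose further that $s>\alpha$. Then almost surely $Y_n^t$ converges uniformly in $t\in\Gamma$, exponentially fast (i.e. $\sup_{t}|Y^t_n-Y^t|\le K2^{-cn}$ for some random $K<\infty$ and some $c>0$), to a limit $Y^t$, and the function $t\mapsto Y^t$ is Hölder continuous with exponent $\gamma$, for any $$0<\gamma<\frac{(s-\alpha)\gamma_0}{s-\alpha+2\theta}.$$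
   Context: An SI-martingale on $\mathbb{R}^d$ is a sequence $(\mu_n)_{n\ge0}$ of random functions $\mu_n:\mathbb{R}^d\to[0,\infty)$ (identified with the measures $\mu_n(x)\,dx$) such that: (SI1) $\mu_0$ is a deterministic bounded function with bounded support; (SI2) there is an increasing filtration $(\mathcal{B}_n)$ with $\mu_n$ $\mathcal{B}_n$-measurable and $\mathbb{E}(\mu_{n+1}(x)\mid\mathcal{B}_n)=\mu_n(x)$ for all $x$, $n$; (SI3) there is $C<\infty$ with $\mu_{n+1}(x)\le C\mu_n(x)$ for all $x,n$; (SI4) there is $C<\infty$ such that for any $(C2^{-n})$-separated family $\mathcal{Q}$ of half-open dyadic cubes of side length $2^{-(n+1)}$, the restrictions $\{\mu_{n+1}|_Q\}_{Q\in\mathcal{Q}}$ are independent conditionally on $\mathcal{B}_n$. $B(x,r)$ is the closed ball. *)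

theory Defs
  imports "HOL-Probability.Probability"
begin

definition dyadic_cube :: "nat \<Rightarrow> ('d \<Rightarrow> int) \<Rightarrow> (real^'d) set" where
  "dyadic_cube m k = {x. \<forall>i. real_of_int (k i) / 2 ^ m \<le> x $ i \<and> x $ i < real_of_int (k i + 1) / 2 ^ m}"

definition separated_family :: "real \<Rightarrow> ('a::metric_space) set set \<Rightarrow> bool" where
  "separated_family \<delta> \<Q> \<longleftrightarrow>
     (\<forall>Q\<in>\<Q>. \<forall>Q'\<in>\<Q>. Q \<noteq> Q' \<longrightarrow> (\<forall>x\<in>Q. \<forall>y\<in>Q'. \<delta> \<le> dist x y))"

definition restr_events :: "'w measure \<Rightarrow> ('w \<Rightarrow> 'a \<Rightarrow> real) \<Rightarrow> 'a set \<Rightarrow> 'w set set" where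
  "restr_events M X Q =
     {{\<omega> \<in> space M. restrict (X \<omega>) Q \<in> B} | B. B \<in> sets (Pi\<^sub>M Q (\<lambda>_. borel))}"

definition cond_indep_sets :: "'w measure \<Rightarrow> 'w measure \<Rightarrow> ('i \<Rightarrow> 'w set set) \<Rightarrow> 'i set \<Rightarrow> bool" where
  "cond_indep_sets M G A I \<longleftrightarrow>
     (\<forall>J. J \<subseteq> I \<longrightarrow> finite J \<longrightarrow> J \<noteq> {} \<longrightarrow>
       (\<forall>E. (\<forall>j\<in>J. E j \<in> A j) \<longrightarrow>
         (AE \<omega> in M. real_cond_exp M G (indicator (\<Inter>j\<in>J. E j)) \<omega>
                      = (\<Prod>j\<in>J. real_cond_exp M G (indicator (E j)) \<omega>))))"

definition SI_martingale :: "'w measure \<Rightarrow> (nat \<Rightarrow> 'w measure) \<Rightarrow> (nat \<Rightarrow> 'w \<Rightarrow> real^'d \<Rightarrow> real) \<Rightarrow> bool" where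
  "SI_martingale M F \<mu> \<longleftrightarrow>
     prob_space M \<and>
     \<comment> \<open>random nonnegative functions, B_n-measurable (jointly in (omega,x))\<close>
     (\<forall>n. \<forall>\<omega>\<in>space M. \<forall>x. 0 \<le> \<mu> n \<omega> x) \<and>
     (\<forall>n. (\<lambda>(\<omega>, x). \<mu> n \<omega> x) \<in> borel_measurable (F n \<Otimes>\<^sub>M lborel)) \<and>
     \<comment> \<open>(SI1)\<close>
     (\<exists>f. (\<forall>\<omega>\<in>space M. \<mu> 0 \<omega> = f) \<and> (\<exists>B. \<forall>x. f x \<le> B) \<and> bounded {x. f x \<noteq> 0}) \<and>
     \<comment> \<open>(SI2): increasing filtration and martingale property\<close>
     (\<forall>n. subalgebra M (F n)) \<and>
     (\<forall>n. sets (F n) \<subseteq> sets (F (Suc n))) \<and>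
     (\<forall>n x. AE \<omega> in M. real_cond_exp M (F n) (\<lambda>\<omega>. \<mu> (Suc n) \<omega> x) \<omega> = \<mu> n \<omega> x) \<and>
     \<comment> \<open>(SI3)\<close>
     (\<exists>C. \<forall>n. \<forall>\<omega>\<in>space M. \<forall>x. \<mu> (Suc n) \<omega> x \<le> C * \<mu> n \<omega> x) \<and>
     \<comment> \<open>(SI4)\<close>
     (\<exists>C. \<forall>n. \<forall>\<Q>. \<Q> \<subseteq> range (dyadic_cube (Suc n)) \<longrightarrow> separated_family (C / 2 ^ n) \<Q> \<longrightarrow>
        cond_indep_sets M (F n) (restr_events M (\<mu> (Suc n))) \<Q>)"

definition Yint :: "(nat \<Rightarrow> 'w \<Rightarrow> real^'d \<Rightarrow> real) \<Rightarrow> ('g \<Rightarrow> (real^'d) measure) \<Rightarrow> nat \<Rightarrow> 'w \<Rightarrow> 'g \<Rightarrow> real" where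
  "Yint \<mu> \<eta> n \<omega> t = (\<integral>x. \<mu> n \<omega> x \<partial>(\<eta> t))"

end

theory Submission
  imports Defs "HOL-Real_Asymp.Real_Asymp"
begin

text \<open>
  Fix \<open>t\<close> and condition on \<open>B\<^sub>n\<close>. Writing \<open>Y\<^sub>n\<^sub>+\<^sub>1 - Y\<^sub>n\<close> as a sum of integrals over dyadic cubes of
  side \<open>2\<close> to the power \<open>-(n+1)\<close> and splitting the cubes into boundedly many separated classes (by their
  index modulo some \<open>p\<close>), the terms within a class are bounded martingale differences, and the Frostman
  bound (H2) with (H3) makes each of them at most a constant times \<open>a\<^sub>n = 2\<^sup>-\<^sup>(\<^sup>s\<^sup>-\<^sup>\<alpha>\<^sup>)\<^sup>n\<close>. A Bernstein type
  estimate gives \<open>\<bar>Y\<^sub>n\<^sub>+\<^sub>1 - Y\<^sub>n\<bar> \<le> 2\<^sup>-\<^sup>c\<^sup>n (1 + Y\<^sub>n)\<close> outside an event whose probability is superexponentially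
  small, for every \<open>c < (s-\<alpha>)/2\<close>. By (H1) this survives a union bound over a \<open>2\<^sup>-\<^sup>A\<^sup>n\<close>-net of the index set, and
  for large \<open>A\<close> the Hoelder estimate (H4) extends it to all \<open>t\<close>. Hence \<open>Y\<^sub>n\<close> converges uniformly at rate \<open>2\<^sup>-\<^sup>c\<^sup>n\<close>.
  Interpolating between this rate and (H4) at the scale where they balance gives Hoelder exponent
  \<open>c \<gamma>\<^sub>0 / (\<theta> + c)\<close>, and \<open>c\<close> may be taken arbitrarily close to \<open>(s-\<alpha>)/2\<close>.
\<close>

section \<open>Conditional expectations\<close>

text \<open>Two obstacles shape the argument. First, (SI4) controls events determined by the values
  of the density at points of a cube, and the product sigma-algebra over uncountably many points
  need not contain events about integrals. Independence is therefore used for fixed \<open>x\<close>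
  and reaches the integrals through Fubini; martingale differences, one cube at a time, take the
  place of independent summands. Second, Y_n has no a priori bound uniform in n. The sum of the
  squared increments is at most their maximum, of order a_n, times a multiple of Y_n, and dividing
  by 1 + Y_n makes this deterministic. With exponential parameter of order a_n^(-1/2) the
  compensator is of order 1, and a relative deviation 2^(-cn) has probability about
  exp(-2^(((s-\<alpha>)/2-c)n)). A net of entropy 2^(\<epsilon>n), \<epsilon> small, is beaten as
  soon as c < (s-\<alpha>)/2; the square root is the origin of the 2 in front of \<theta> in the
  Hoelder exponent. Boundedness of Y_n comes out afterwards, because the product of the growth
  factors 1 + const 2^(-cn) converges.\<close>

text \<open>Joint measurability does not make the integral measurable with respect to the \<open>\<sigma>\<close>-algebra generated by
  the values \<open>h \<omega> x\<close>, but it does so up to a null set: if \<open>Z\<close> is the conditional expectation of the integral \<open>I\<close>,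
  then \<open>I - Z\<close> is orthogonal to every \<open>h \<omega> x\<close>, hence by Fubini to \<open>I\<close>, and also to \<open>Z\<close>.\<close>

lemma parametric_integral_AE_measurable:
  fixes h :: "'w \<Rightarrow> 'a \<Rightarrow> real"
  assumes M: "finite_measure M" and V: "subalgebra M V" and N: "finite_measure N"
    and h[measurable]: "(\<lambda>(\<omega>, x). h \<omega> x) \<in> borel_measurable (M \<Otimes>\<^sub>M N)"
    and bd: "\<And>\<omega> x. \<omega> \<in> space M \<Longrightarrow> x \<in> space N \<Longrightarrow> \<bar>h \<omega> x\<bar> \<le> B"
    and hV: "\<And>x. x \<in> space N \<Longrightarrow> (\<lambda>\<omega>. h \<omega> x) \<in> borel_measurable V"
  shows "\<exists>Z\<in>borel_measurable V. AE \<omega> in M. Z \<omega> = (\<integral>x. h \<omega> x \<partial>N)"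
proof -
  interpret M: finite_measure M by fact
  interpret N: finite_measure N by fact
  interpret V: finite_measure_subalgebra M V by unfold_locales (fact V)
  interpret P: pair_sigma_finite M N ..
  interpret P: finite_measure "M \<Otimes>\<^sub>M N"
    by (rule finite_measure_pair_measure) (fact N, fact M)
  define I where "I \<omega> = (\<integral>x. h \<omega> x \<partial>N)" for \<omega>
  define b where "b = \<bar>B\<bar> * measure N (space N)"
  have hx[measurable]: "(\<lambda>\<omega>. h \<omega> x) \<in> borel_measurable M" if "x \<in> space N" for x
    using measurable_from_subalg[OF V hV[OF that]] .
  have I[measurable]: "I \<in> borel_measurable M"
    unfolding I_def by measurable
  have Ib: "\<bar>I \<omega>\<bar> \<le> b" if w: "\<omega> \<in> space M" for \<omega>
  proof -
    have "\<bar>I \<omega>\<bar> \<le> (\<integral>x. \<bar>h \<omega> x\<bar> \<partial>N)"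
      unfolding I_def by (rule integral_abs_bound)
    also have "\<dots> \<le> (\<integral>x. \<bar>B\<bar> \<partial>N)"
      using bd[OF w] by (intro integral_mono' ) (auto intro: order_trans[OF _ abs_ge_self])
    finally show ?thesis by (simp add: b_def mult.commute)
  qed
  have b0: "0 \<le> b" by (simp add: b_def)
  \<comment> \<open>A conditional expectation is controlled only almost everywhere; truncating it at
    the bound \<open>b\<close> of \<open>I\<close> gives a version bounded everywhere, so that
    \<open>Z\<close> itself may serve as a multiplier in \<open>orth\<close>.\<close>
  define Z where "Z = (\<lambda>\<omega>. max (- b) (min b (real_cond_exp M V I \<omega>)))"
  have ZV[measurable]: "Z \<in> borel_measurable V" unfolding Z_def by measurable
  have Z[measurable]: "Z \<in> borel_measurable M" by (rule measurable_from_subalg[OF V ZV])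
  have Zb: "\<bar>Z \<omega>\<bar> \<le> b" for \<omega> using b0 by (auto simp: Z_def)
  have intI: "integrable M I"
    by (rule M.integrable_const_bound[of _ b]) (auto simp: Ib)
  have AEZ: "AE \<omega> in M. real_cond_exp M V I \<omega> = Z \<omega>"
  proof -
    have "AE \<omega> in M. - b \<le> I \<omega>" "AE \<omega> in M. I \<omega> \<le> b"
      using Ib by (auto intro!: AE_I2 simp: abs_le_iff minus_le_iff)
    from V.real_cond_exp_ge_c[OF intI this(1)] V.real_cond_exp_le_c[OF intI this(2)]
    show ?thesis by eventually_elim (auto simp: Z_def)
  qed
  have orth: "(\<integral>\<omega>. k \<omega> * (I \<omega> - Z \<omega>) \<partial>M) = 0"
    if k[measurable]: "k \<in> borel_measurable V" and kb: "\<And>\<omega>. \<omega> \<in> space M \<Longrightarrow> \<bar>k \<omega>\<bar> \<le> c" for k c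
  proof -
    have [measurable]: "k \<in> borel_measurable M" by (rule measurable_from_subalg[OF V k])
    have i1: "integrable M (\<lambda>\<omega>. k \<omega> * I \<omega>)"
      by (rule M.integrable_const_bound[of _ "c * b"])
         (auto simp: abs_mult intro!: mult_mono kb Ib order_trans[OF abs_ge_zero kb])
    have i2: "integrable M (\<lambda>\<omega>. k \<omega> * Z \<omega>)"
      by (rule M.integrable_const_bound[of _ "c * b"])
         (auto simp: abs_mult intro!: mult_mono kb Zb order_trans[OF abs_ge_zero kb])
    have "(\<integral>\<omega>. k \<omega> * Z \<omega> \<partial>M) = (\<integral>\<omega>. k \<omega> * real_cond_exp M V I \<omega> \<partial>M)"
      using AEZ by (intro integral_cong_AE) (auto elim!: eventually_mono)
    also have "\<dots> = (\<integral>\<omega>. k \<omega> * I \<omega> \<partial>M)"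
      by (rule V.real_cond_exp_intg(2)) (use i1 in auto)
    finally show ?thesis using i1 i2 by (simp add: right_diff_distrib)
  qed
  have "(\<integral>\<omega>. I \<omega> * (I \<omega> - Z \<omega>) \<partial>M) = (\<integral>\<omega>. (\<integral>x. h \<omega> x * (I \<omega> - Z \<omega>) \<partial>N) \<partial>M)"
    by (simp add: I_def)
  also have "\<dots> = (\<integral>x. (\<integral>\<omega>. h \<omega> x * (I \<omega> - Z \<omega>) \<partial>M) \<partial>N)"
  proof (rule P.Fubini_integral[symmetric])
    show "integrable (M \<Otimes>\<^sub>M N) (\<lambda>(\<omega>, x). h \<omega> x * (I \<omega> - Z \<omega>))"
    proof (rule P.integrable_const_bound[of _ "\<bar>B\<bar> * (b + b)"])
      show "AE p in M \<Otimes>\<^sub>M N. norm (case p of (\<omega>, x) \<Rightarrow> h \<omega> x * (I \<omega> - Z \<omega>)) \<le> \<bar>B\<bar> * (b + b)"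
      proof (intro AE_I2)
        fix p assume "p \<in> space (M \<Otimes>\<^sub>M N)"
        then obtain \<omega> x where p: "p = (\<omega>, x)" "\<omega> \<in> space M" "x \<in> space N"
          by (auto simp: space_pair_measure)
        have "\<bar>h \<omega> x\<bar> * \<bar>I \<omega> - Z \<omega>\<bar> \<le> \<bar>B\<bar> * (b + b)"
          using bd[OF p(2,3)] Ib[OF p(2)] Zb[of \<omega>] by (intro mult_mono) auto
        then show "norm (case p of (\<omega>, x) \<Rightarrow> h \<omega> x * (I \<omega> - Z \<omega>)) \<le> \<bar>B\<bar> * (b + b)"
          by (simp add: p abs_mult)
      qed
    qed measurable
  qed
  also have "\<dots> = (\<integral>x. 0 \<partial>N)"
    by (intro Bochner_Integration.integral_cong refl orth[where c = B] hV bd)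
  finally have "(\<integral>\<omega>. I \<omega> * (I \<omega> - Z \<omega>) \<partial>M) = 0" by simp
  moreover have "(\<integral>\<omega>. Z \<omega> * (I \<omega> - Z \<omega>) \<partial>M) = 0"
    by (rule orth[where c = b]) (auto simp: Zb)
  moreover have prod_int: "integrable M (\<lambda>\<omega>. u \<omega> * (I \<omega> - Z \<omega>))"
    if [measurable]: "u \<in> borel_measurable M" and ub: "\<And>\<omega>. \<omega> \<in> space M \<Longrightarrow> \<bar>u \<omega>\<bar> \<le> c" for u c
  proof (rule M.integrable_const_bound[of _ "c * (b + b)"])
    show "AE \<omega> in M. norm (u \<omega> * (I \<omega> - Z \<omega>)) \<le> c * (b + b)"
    proof (intro AE_I2)
      fix \<omega> assume w: "\<omega> \<in> space M"
      have "\<bar>u \<omega>\<bar> * \<bar>I \<omega> - Z \<omega>\<bar> \<le> c * (b + b)"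
        using ub[OF w] Ib[OF w] Zb[of \<omega>] by (intro mult_mono) auto
      then show "norm (u \<omega> * (I \<omega> - Z \<omega>)) \<le> c * (b + b)" by (simp add: abs_mult)
    qed
  qed measurable
  ultimately have "(\<integral>\<omega>. (I \<omega> - Z \<omega>) * (I \<omega> - Z \<omega>) \<partial>M) = 0"
    using prod_int[OF I Ib] prod_int[OF Z Zb] by (simp add: left_diff_distrib)
  moreover have "integrable M (\<lambda>\<omega>. (I \<omega> - Z \<omega>) * (I \<omega> - Z \<omega>))"
    using prod_int[OF I Ib] prod_int[OF Z Zb] by (simp add: left_diff_distrib)
  ultimately have "AE \<omega> in M. (I \<omega> - Z \<omega>) * (I \<omega> - Z \<omega>) = 0"
    by (subst (asm) integral_nonneg_eq_0_iff_AE) auto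
  then have "AE \<omega> in M. Z \<omega> = I \<omega>" by eventually_elim auto
  with ZV show ?thesis unfolding I_def by blast
qed

text \<open>Passes from events of \<open>S\<close> to bounded functions without approximation by
  simple functions. With p = E(1_H | G), the factorisation says that \<open>k\<close>, that is 1_B
  (1_H - p), integrates to zero over every set of \<open>S\<close>; so its conditional expectation
  given \<open>S\<close> vanishes and \<open>k\<close> is orthogonal to \<open>f\<close>. This
  trades 1_H for p; the weight 1_B p is \<open>G\<close>-measurable, so \<open>f\<close> may be
  replaced by its conditional expectation, and then p by 1_H again.\<close>

lemma cond_indep_event_function:
  assumes "prob_space M" and G: "subalgebra M G" and S: "subalgebra M S"
    and B: "B \<in> sets G" and H: "H \<in> sets M"
    and ind: "\<And>E. E \<in> sets S \<Longrightarrow> AE \<omega> in M. real_cond_exp M G (indicator (H \<inter> E)) \<omega>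
                = real_cond_exp M G (indicator H) \<omega> * real_cond_exp M G (indicator E) \<omega>"
    and f: "f \<in> borel_measurable S"
    and fb: "\<And>\<omega>. \<omega> \<in> space M \<Longrightarrow> \<bar>f \<omega>\<bar> \<le> (c :: real)"
  shows "(\<integral>\<omega>. indicator (B \<inter> H) \<omega> * f \<omega> \<partial>M) = (\<integral>\<omega>. indicator (B \<inter> H) \<omega> * real_cond_exp M G f \<omega> \<partial>M)"
proof -
  interpret prob_space M by fact
  interpret G: finite_measure_subalgebra M G by unfold_locales (fact G)
  interpret S: finite_measure_subalgebra M S by unfold_locales (fact S)
  note [measurable] = B H f
  have BM[measurable]: "B \<in> sets M" using B G by (auto simp: subalgebra_def)
  have fM[measurable]: "f \<in> borel_measurable M" by (rule measurable_from_subalg[OF S f])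
  define p where "p = real_cond_exp M G (indicator H)"
  have [measurable]: "p \<in> borel_measurable G" "p \<in> borel_measurable M" by (auto simp: p_def)
  define k where "k = (\<lambda>\<omega>. indicator B \<omega> * (indicator H \<omega> - p \<omega>))"
  have [measurable]: "k \<in> borel_measurable M" by (auto simp: k_def)
  have int_ind: "integrable M (\<lambda>\<omega>. indicator X \<omega> * indicator Y \<omega> :: real)"
    if "X \<in> sets M" "Y \<in> sets M" for X Y
    using that by (intro integrable_const_bound[of _ 1]) (auto simp: indicator_def)
  have int_p: "integrable M p"
    unfolding p_def by (rule G.real_cond_exp_int) (simp add: integrable_indicator_iff less_top[symmetric])
  have int_Bp: "integrable M (\<lambda>\<omega>. indicator B \<omega> * p \<omega>)"
    using integrable_real_mult_indicator[OF BM int_p] by (simp add: mult.commute)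
  have int_k: "integrable M k"
    using int_Bp int_ind[OF BM H] by (simp add: k_def right_diff_distrib)
  have "(\<integral>\<omega>\<in>E. k \<omega> \<partial>M) = 0" if E: "E \<in> sets S" for E
  proof -
    have EM[measurable]: "E \<in> sets M" using E S by (auto simp: subalgebra_def)
    have iBpE: "integrable M (\<lambda>\<omega>. indicator B \<omega> * p \<omega> * indicator E \<omega>)"
      by (rule integrable_real_mult_indicator[OF EM int_Bp])
    have iBHE: "integrable M (\<lambda>\<omega>. indicator B \<omega> * indicator (H \<inter> E) \<omega> :: real)"
      by (rule int_ind) auto
    have "(\<integral>\<omega>. indicator B \<omega> * indicator (H \<inter> E) \<omega> \<partial>M)
        = (\<integral>\<omega>. indicator B \<omega> * real_cond_exp M G (indicator (H \<inter> E)) \<omega> \<partial>M)"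
      by (rule G.real_cond_exp_intg(2)[symmetric]) (use iBHE in auto)
    also have "\<dots> = (\<integral>\<omega>. indicator B \<omega> * p \<omega> * real_cond_exp M G (indicator E) \<omega> \<partial>M)"
      using ind[OF E] by (intro integral_cong_AE) (auto simp: p_def elim!: eventually_mono)
    also have "\<dots> = (\<integral>\<omega>. indicator B \<omega> * p \<omega> * indicator E \<omega> \<partial>M)"
      by (rule G.real_cond_exp_intg(2)) (use iBpE in auto)
    finally have "(\<integral>\<omega>. indicator B \<omega> * indicator (H \<inter> E) \<omega> - indicator B \<omega> * p \<omega> * indicator E \<omega> \<partial>M) = 0"
      using iBpE iBHE by simp
    then show ?thesis
      unfolding set_lebesgue_integral_def k_def
      by (simp add: algebra_simps indicator_inter_arith)
  qed
  then have k0: "AE \<omega> in M. real_cond_exp M S k \<omega> = 0"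
    by (intro S.real_cond_exp_charact) (auto simp: int_k)
  have f_mult: "integrable M (\<lambda>\<omega>. f \<omega> * u \<omega>)" if u: "integrable M u" for u
  proof (rule Bochner_Integration.integrable_bound[where f = "\<lambda>\<omega>. c * u \<omega>"])
    show "AE \<omega> in M. norm (f \<omega> * u \<omega>) \<le> norm (c * u \<omega>)"
      by (intro AE_I2) (auto simp: abs_mult intro!: mult_right_mono[OF order_trans[OF fb abs_ge_self] abs_ge_zero])
  qed (use u in auto)
  have "(\<integral>\<omega>. f \<omega> * k \<omega> \<partial>M) = (\<integral>\<omega>. f \<omega> * real_cond_exp M S k \<omega> \<partial>M)"
    by (rule S.real_cond_exp_intg(2)[symmetric]) (use f_mult[OF int_k] in auto)
  also have "\<dots> = (\<integral>\<omega>. 0 \<partial>M)"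
    using k0 by (intro integral_cong_AE) (auto elim!: eventually_mono)
  finally have fk: "(\<integral>\<omega>. f \<omega> * k \<omega> \<partial>M) = 0" by simp
  have i1: "integrable M (\<lambda>\<omega>. f \<omega> * (indicator B \<omega> * indicator H \<omega>))"
    by (rule f_mult[OF int_ind]) auto
  have i2: "integrable M (\<lambda>\<omega>. f \<omega> * (indicator B \<omega> * p \<omega>))"
    by (rule f_mult[OF int_Bp])
  have int_f: "integrable M f" 
    by (rule integrable_const_bound[of _ c]) (auto simp: fb)
  have int_BF: "integrable M (\<lambda>\<omega>. indicator B \<omega> * real_cond_exp M G f \<omega> * indicator H \<omega>)"
    using integrable_real_mult_indicator[OF H integrable_real_mult_indicator[OF BM G.real_cond_exp_int(1)[OF int_f]]]
    by (simp add: mult_ac)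
  have "(\<integral>\<omega>. indicator (B \<inter> H) \<omega> * f \<omega> \<partial>M) = (\<integral>\<omega>. f \<omega> * (indicator B \<omega> * indicator H \<omega>) \<partial>M)"
    by (simp add: indicator_inter_arith mult_ac)
  also have "\<dots> = (\<integral>\<omega>. f \<omega> * (indicator B \<omega> * p \<omega>) \<partial>M)"
    using fk i1 i2 by (simp add: k_def right_diff_distrib)
  also have "\<dots> = (\<integral>\<omega>. indicator B \<omega> * p \<omega> * f \<omega> \<partial>M)" by (simp add: mult_ac)
  also have "\<dots> = (\<integral>\<omega>. indicator B \<omega> * p \<omega> * real_cond_exp M G f \<omega> \<partial>M)"
    by (rule G.real_cond_exp_intg(2)[symmetric]) (use i2 in \<open>auto simp: mult_ac\<close>)
  also have "\<dots> = (\<integral>\<omega>. indicator B \<omega> * real_cond_exp M G f \<omega> * p \<omega> \<partial>M)" by (simp add: mult_ac)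
  also have "\<dots> = (\<integral>\<omega>. indicator B \<omega> * real_cond_exp M G f \<omega> * indicator H \<omega> \<partial>M)"
    unfolding p_def by (rule G.real_cond_exp_intg(2)) (use int_BF in auto)
  also have "\<dots> = (\<integral>\<omega>. indicator (B \<inter> H) \<omega> * real_cond_exp M G f \<omega> \<partial>M)"
    by (simp add: indicator_inter_arith mult_ac)
  finally show ?thesis .
qed

section \<open>One step of the martingale\<close>

lemma restr_events_eq_sets:
  "restr_events M X Q = sets (vimage_algebra (space M) (\<lambda>\<omega>. restrict (X \<omega>) Q) (Pi\<^sub>M Q (\<lambda>_. borel)))"
  by (subst sets_vimage_algebra2) (auto simp: restr_events_def space_PiM PiE_def)

lemma exp_le_one_plus_quadratic:
  fixes y :: real
  assumes "\<bar>y\<bar> \<le> 1"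
  shows "exp y \<le> 1 + y + y\<^sup>2"
proof (cases "0 \<le> y")
  case True
  then show ?thesis using assms exp_bound[of y] by auto
next
  case False
  define t where "t = - y"
  have t: "0 \<le> t" "y = - t" using False by (auto simp: t_def)
  \<comment> \<open>For y = -t the claim amounts to 1 <= (1 - t + t^2) exp t. The quadratic Taylor
    polynomial of exp t suffices: in the product the linear terms cancel and all other coefficients
    are positive.\<close>
  have "1 \<le> 1 + (t\<^sup>2 + t ^ 3 + t ^ 4) / 2" using t(1) by simp
  also have "\<dots> = (1 - t + t\<^sup>2) * (1 + t + t\<^sup>2 / 2)"
    by (simp add: field_simps power2_eq_square power3_eq_cube power4_eq_xxxx)
  also have "\<dots> \<le> (1 - t + t\<^sup>2) * exp t"
  proof (rule mult_left_mono)
    show "1 + t + t\<^sup>2 / 2 \<le> exp t" using exp_lower_Taylor_quadratic[OF t(1)] by simp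
    have "0 \<le> (1 - t / 2)\<^sup>2 + 3 / 4 * t\<^sup>2" by (intro add_nonneg_nonneg) auto
    then show "0 \<le> 1 - t + t\<^sup>2" by (simp add: power2_eq_square algebra_simps)
  qed
  finally have "exp (- t) \<le> 1 - t + t\<^sup>2"
    by (simp add: exp_minus field_simps)
  then show ?thesis by (simp add: t(2))
qed

text \<open>\<open>g\<close> and \<open>f\<close> stand for the densities at times n and n+1,
  \<open>N\<close> for one \<open>\<eta> t\<close>, and \<open>\<Q>\<close> for one separated class
  of cubes. The bound \<open>B\<close> may depend on n: it provides integrability, while the
  quantitative estimates come from a bound \<open>a\<close> on the cube masses.
  \<open>1 \<le> K\<close> makes \<open>K * g\<close> dominate both \<open>f\<close> and
  \<open>g\<close>, hence their difference.\<close>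

locale one_step = prob_space M
  for M :: "'w measure" +
  fixes G :: "'w measure" and f g :: "'w \<Rightarrow> 'a \<Rightarrow> real" and N :: "'a measure"
    and K B :: real and \<Q> :: "'a set set"
  assumes G: "subalgebra M G"
    and N: "finite_measure N"
    and space_N: "space N = UNIV"
    and f_meas: "(\<lambda>(\<omega>, x). f \<omega> x) \<in> borel_measurable (M \<Otimes>\<^sub>M N)"
    and g_meas: "(\<lambda>(\<omega>, x). g \<omega> x) \<in> borel_measurable (G \<Otimes>\<^sub>M N)"
    and mart: "\<And>x. AE \<omega> in M. real_cond_exp M G (\<lambda>\<omega>. f \<omega> x) \<omega> = g \<omega> x"
    and f_nonneg: "\<And>\<omega> x. \<omega> \<in> space M \<Longrightarrow> 0 \<le> f \<omega> x"
    and g_nonneg: "\<And>\<omega> x. \<omega> \<in> space M \<Longrightarrow> 0 \<le> g \<omega> x"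
    and f_le: "\<And>\<omega> x. \<omega> \<in> space M \<Longrightarrow> f \<omega> x \<le> K * g \<omega> x"
    and g_le: "\<And>\<omega> x. \<omega> \<in> space M \<Longrightarrow> g \<omega> x \<le> B"
    and K: "1 \<le> K"
    and fin: "finite \<Q>"
    and disj: "disjoint \<Q>"
    and \<Q>_sets: "\<And>Q. Q \<in> \<Q> \<Longrightarrow> Q \<in> sets N"
    and ci: "cond_indep_sets M G (restr_events M f) \<Q>"
begin

sublocale N: finite_measure N by (rule N)
sublocale G: finite_measure_subalgebra M G by unfold_locales (rule G)
sublocale P: pair_sigma_finite M N ..

lemma space_G: "space G = space M"
  using G by (simp add: subalgebra_def)

lemma g_meas_M: "(\<lambda>(\<omega>, x). g \<omega> x) \<in> borel_measurable (M \<Otimes>\<^sub>M N)"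
proof -
  have "(\<lambda>p. (fst p, snd p)) \<in> measurable (M \<Otimes>\<^sub>M N) (G \<Otimes>\<^sub>M N)"
    by (intro measurable_Pair measurable_compose[OF measurable_fst] measurable_snd
        measurable_from_subalg[OF G] measurable_ident)
      (auto simp: measurable_def)
  from measurable_compose[OF this g_meas] show ?thesis by simp
qed

lemmas [measurable] = f_meas g_meas g_meas_M \<Q>_sets

lemma f_sec[measurable]: "(\<lambda>\<omega>. f \<omega> x) \<in> borel_measurable M"
proof -
  have "(\<lambda>\<omega>. (\<omega>, x)) \<in> measurable M (M \<Otimes>\<^sub>M N)"
    by (rule measurable_Pair2') (simp add: space_N)
  from measurable_compose[OF this f_meas] show ?thesis by simp
qed

lemma g_sec[measurable]: "(\<lambda>\<omega>. g \<omega> x) \<in> borel_measurable G"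
proof -
  have "(\<lambda>\<omega>. (\<omega>, x)) \<in> measurable G (G \<Otimes>\<^sub>M N)"
    by (rule measurable_Pair2') (simp add: space_N)
  from measurable_compose[OF this g_meas] show ?thesis by simp
qed

lemma g_sec_M[measurable]: "(\<lambda>\<omega>. g \<omega> x) \<in> borel_measurable M"
  by (rule measurable_from_subalg[OF G g_sec])

lemma f_bound: "\<omega> \<in> space M \<Longrightarrow> \<bar>f \<omega> x\<bar> \<le> K * B"
  using f_le[of \<omega> x] g_le[of \<omega> x] f_nonneg[of \<omega> x] K
  by (smt (verit) mult_left_mono)

lemma g_bound: "\<omega> \<in> space M \<Longrightarrow> \<bar>g \<omega> x\<bar> \<le> B"
  using g_le[of \<omega> x] g_nonneg[of \<omega> x] by auto

lemma diff_bound: "\<omega> \<in> space M \<Longrightarrow> \<bar>f \<omega> x - g \<omega> x\<bar> \<le> K * g \<omega> x"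
  using f_le[of \<omega> x] f_nonneg[of \<omega> x] g_nonneg[of \<omega> x] mult_right_mono[OF K, of "g \<omega> x"]
  by auto

lemma integrable_f: "integrable M (\<lambda>\<omega>. f \<omega> x)"
  by (rule integrable_const_bound[of _ "K * B"]) (auto simp: f_bound)

lemma integrable_g: "integrable M (\<lambda>\<omega>. g \<omega> x)"
  by (rule integrable_const_bound[of _ B]) (auto simp: g_bound)

text \<open>\<open>past J\<close> is generated by \<open>G\<close> and the values of \<open>f\<close> on the cubes in \<open>J\<close>. Conditional independence is used
  only in the form that \<open>f - g\<close> on a further cube is a martingale difference with respect to it.\<close>

definition past_gen :: "'a set set \<Rightarrow> 'w set set" where
  "past_gen J = {C \<inter> (\<Inter>Q\<in>J. A Q) |C A. C \<in> sets G \<and> (\<forall>Q\<in>J. A Q \<in> restr_events M f Q)}"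

definition past :: "'a set set \<Rightarrow> 'w measure" where
  "past J = sigma (space M) (past_gen J)"

definition loc :: "'a set \<Rightarrow> 'w measure" where
  "loc Q = vimage_algebra (space M) (\<lambda>\<omega>. restrict (f \<omega>) Q) (Pi\<^sub>M Q (\<lambda>_. borel))"

lemma sets_loc: "sets (loc Q) = restr_events M f Q"
  by (simp add: loc_def restr_events_eq_sets)

lemma loc_subalgebra: "subalgebra M (loc Q)"
  unfolding subalgebra_def
proof
  have "(\<lambda>\<omega>. restrict (f \<omega>) Q) \<in> measurable M (Pi\<^sub>M Q (\<lambda>_. borel))"
    by (rule measurable_restrict) measurable
  then have "sets (loc Q) \<subseteq> sets M"
    unfolding loc_def by (intro sets_image_in_sets) auto
  then show "sets (loc Q) \<subseteq> sets M" .
qed (simp add: loc_def)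

lemma f_loc: "x \<in> Q \<Longrightarrow> (\<lambda>\<omega>. f \<omega> x) \<in> borel_measurable (loc Q)"
proof -
  assume x: "x \<in> Q"
  have "(\<lambda>\<omega>. restrict (f \<omega>) Q) \<in> measurable (loc Q) (Pi\<^sub>M Q (\<lambda>_. borel))"
    unfolding loc_def by (rule measurable_vimage_algebra1) (auto simp: space_PiM)
  from measurable_compose[OF this measurable_component_singleton[OF x]] x
  show ?thesis by simp
qed

lemma past_gen_sets:
  assumes "finite J" shows "past_gen J \<subseteq> sets M"
proof
  fix X assume "X \<in> past_gen J"
  then obtain C A where X: "X = C \<inter> (\<Inter>Q\<in>J. A Q)" and C: "C \<in> sets G"
    and A: "\<And>Q. Q \<in> J \<Longrightarrow> A Q \<in> restr_events M f Q"
    by (auto simp: past_gen_def)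
  have "C \<in> sets M" using C G by (auto simp: subalgebra_def)
  moreover have "A Q \<in> sets M" if "Q \<in> J" for Q
    using A[OF that] loc_subalgebra[of Q] by (auto simp: sets_loc subalgebra_def)
  ultimately show "X \<in> sets M"
    using assms unfolding X by (cases "J = {}") (auto intro!: sets.Int sets.finite_INT)
qed

lemma past_gen_Pow: "past_gen J \<subseteq> Pow (space M)"
  using sets.sets_into_space[of _ G] by (auto simp: past_gen_def space_G)

lemma space_past: "space (past J) = space M"
  unfolding past_def by (rule space_measure_of[OF past_gen_Pow])

lemma sets_past: "sets (past J) = sigma_sets (space M) (past_gen J)"
  unfolding past_def by (rule sets_measure_of[OF past_gen_Pow])

lemma past_subalgebra:
  assumes "finite J" shows "subalgebra M (past J)"
  unfolding subalgebra_def sets_past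
  using sets.sigma_sets_subset[OF past_gen_sets[OF assms]] by (simp add: space_past)

lemma Int_stable_past_gen: "Int_stable (past_gen J)"
proof (rule Int_stableI)
  fix X Y assume "X \<in> past_gen J" "Y \<in> past_gen J"
  then obtain C A C' A' where *: "X = C \<inter> (\<Inter>Q\<in>J. A Q)" "C \<in> sets G"
    "\<And>Q. Q \<in> J \<Longrightarrow> A Q \<in> restr_events M f Q"
    "Y = C' \<inter> (\<Inter>Q\<in>J. A' Q)" "C' \<in> sets G"
    "\<And>Q. Q \<in> J \<Longrightarrow> A' Q \<in> restr_events M f Q"
    unfolding past_gen_def by auto
  have "X \<inter> Y = (C \<inter> C') \<inter> (\<Inter>Q\<in>J. A Q \<inter> A' Q)" using * by auto
  moreover have "A Q \<inter> A' Q \<in> restr_events M f Q" if "Q \<in> J" for Q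
    using *(3,6)[OF that] unfolding restr_events_eq_sets by (rule sets.Int)
  ultimately show "X \<inter> Y \<in> past_gen J"
    using *(2,5) unfolding past_gen_def by blast
qed

lemma G_subset_past: "sets G \<subseteq> sets (past J)"
proof
  fix C assume C: "C \<in> sets G"
  have "space M \<in> restr_events M f Q" for Q
    using sets.top[of "loc Q"] by (simp add: sets_loc) (simp add: loc_def)
  moreover have "C = C \<inter> (\<Inter>Q\<in>J. space M)"
    using sets.sets_into_space[OF C] by (auto simp: space_G)
  ultimately have "C \<in> past_gen J" using C unfolding past_gen_def by blast
  then show "C \<in> sets (past J)" by (simp add: sets_past)
qed

lemma loc_subset_past: "Q \<in> J \<Longrightarrow> sets (loc Q) \<subseteq> sets (past J)"
proof
  fix E assume Q: "Q \<in> J" and E: "E \<in> sets (loc Q)"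
  have top: "space M \<in> restr_events M f Q" for Q
    using sets.top[of "loc Q"] by (simp add: sets_loc) (simp add: loc_def)
  define A where "A = (\<lambda>Q'. if Q' = Q then E else space M)"
  have "E \<subseteq> space M" using sets.sets_into_space[OF E] by (simp add: loc_def)
  then have "E = space M \<inter> (\<Inter>Q'\<in>J. A Q')" using Q by (auto simp: A_def split: if_splits)
  moreover have "\<forall>Q'\<in>J. A Q' \<in> restr_events M f Q'" using top E by (simp add: A_def sets_loc)
  moreover have "space M \<in> sets G" using sets.top[of G] by (simp add: space_G)
  ultimately have "E \<in> past_gen J" unfolding past_gen_def by blast
  then show "E \<in> sets (past J)" by (simp add: sets_past)
qed

lemma G_meas_past: "h \<in> borel_measurable G \<Longrightarrow> h \<in> borel_measurable (past J)"
  by (rule measurable_from_subalg[of "past J" G])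
    (auto simp: subalgebra_def space_past space_G G_subset_past)

lemma f_meas_past: "x \<in> Q \<Longrightarrow> Q \<in> J \<Longrightarrow> (\<lambda>\<omega>. f \<omega> x) \<in> borel_measurable (past J)"
  by (rule measurable_from_subalg[of "past J" "loc Q"])
    (simp_all add: f_loc subalgebra_def space_past loc_subset_past, simp add: loc_def)

text \<open>On a generator (SI4) applies directly: given \<open>G\<close>, the event over
  \<open>J\<close> is independent of the values on \<open>Q\<close>, so under its indicator
  \<open>f\<close> at \<open>x\<close> may be replaced by its conditional expectation given
  \<open>G\<close>, which is \<open>g\<close> by the martingale property.\<close>

lemma set_integral_diff_past_gen:
  assumes J: "J \<subseteq> \<Q>" and Q: "Q \<in> \<Q>" "Q \<notin> J" "x \<in> Q" and X: "X \<in> past_gen J"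
  shows "(\<integral>\<omega>\<in>X. f \<omega> x \<partial>M) = (\<integral>\<omega>\<in>X. g \<omega> x \<partial>M)"
proof -
  obtain C A where X: "X = C \<inter> (\<Inter>Q\<in>J. A Q)" and C: "C \<in> sets G"
    and A: "\<And>Q. Q \<in> J \<Longrightarrow> A Q \<in> restr_events M f Q"
    using X by (auto simp: past_gen_def)
  have finJ: "finite J" using J fin by (rule finite_subset)
  have XM[measurable]: "X \<in> sets M"
    using assms past_gen_sets[OF finJ] by auto
  have "(\<integral>\<omega>\<in>X. f \<omega> x \<partial>M) = (\<integral>\<omega>\<in>X. real_cond_exp M G (\<lambda>\<omega>. f \<omega> x) \<omega> \<partial>M)"
  \<comment> \<open>\<open>cond_indep_sets\<close> speaks of nonempty subfamilies; for empty
    \<open>J\<close> the event lies in \<open>G\<close> and the defining property of the conditional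
    expectation is enough.\<close>
  proof (cases "J = {}")
    case True
    then show ?thesis using G.real_cond_exp_intA[OF integrable_f C] by (simp add: X)
  next
    case False
    define H where "H = (\<Inter>Q\<in>J. A Q)"
    have AM: "A Q \<in> sets M" if "Q \<in> J" for Q
      using A[OF that] loc_subalgebra[of Q] by (auto simp: sets_loc subalgebra_def)
    then have HM: "H \<in> sets M" unfolding H_def using False finJ by auto
    have cH: "AE \<omega> in M. real_cond_exp M G (indicator H) \<omega>
                      = (\<Prod>j\<in>J. real_cond_exp M G (indicator (A j)) \<omega>)"
      using ci J finJ False A unfolding cond_indep_sets_def H_def by auto
    have "AE \<omega> in M. real_cond_exp M G (indicator (H \<inter> E)) \<omega>
                = real_cond_exp M G (indicator H) \<omega> * real_cond_exp M G (indicator E) \<omega>"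
      if E: "E \<in> sets (loc Q)" for E
    proof -
      \<comment> \<open>Comparing the product formulas for \<open>J\<close> and for
        \<open>insert Q J\<close> isolates the factor of \<open>E\<close>.\<close>
      define A' where "A' = A(Q := E)"
      have "\<forall>j\<in>insert Q J. A' j \<in> restr_events M f j"
        using A E by (auto simp: A'_def sets_loc)
      then have "AE \<omega> in M. real_cond_exp M G (indicat_real (\<Inter>j\<in>insert Q J. A' j)) \<omega>
                      = (\<Prod>j\<in>insert Q J. real_cond_exp M G (indicator (A' j)) \<omega>)"
        using ci[unfolded cond_indep_sets_def, rule_format, of "insert Q J" A'] J Q finJ by auto
      moreover have "(\<Inter>j\<in>insert Q J. A' j) = H \<inter> E"
        using Q(2) by (auto simp: H_def A'_def split: if_splits)
      moreover have "(\<Prod>j\<in>insert Q J. real_cond_exp M G (indicator (A' j)) \<omega>)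
          = real_cond_exp M G (indicator E) \<omega> * (\<Prod>j\<in>J. real_cond_exp M G (indicator (A j)) \<omega>)" for \<omega>
      proof -
        have "(\<Prod>j\<in>J. real_cond_exp M G (indicator (A' j)) \<omega>) = (\<Prod>j\<in>J. real_cond_exp M G (indicator (A j)) \<omega>)"
          using Q(2) by (intro prod.cong) (auto simp: A'_def)
        then show ?thesis using Q(2) finJ by (simp add: A'_def)
      qed
      ultimately have "AE \<omega> in M. real_cond_exp M G (indicator (H \<inter> E)) \<omega>
          = real_cond_exp M G (indicator E) \<omega> * (\<Prod>j\<in>J. real_cond_exp M G (indicator (A j)) \<omega>)"
        by simp
      with cH show ?thesis by eventually_elim simp
    qed
    from cond_indep_event_function[OF prob_space_axioms G loc_subalgebra C HM this f_loc[OF Q(3)] f_bound]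
    show ?thesis unfolding set_lebesgue_integral_def X H_def by simp
  qed
  also have "\<dots> = (\<integral>\<omega>\<in>X. g \<omega> x \<partial>M)"
    unfolding set_lebesgue_integral_def
    using mart[of x] by (intro integral_cong_AE) (auto elim!: eventually_mono)
  finally show ?thesis .
qed

text \<open>Pi-lambda argument: \<open>past_gen J\<close> is closed under intersection, and the sets
  over which \<open>f - g\<close> at \<open>x\<close> integrates to zero form a Dynkin class.
  Complements need the whole space, where the claim is equality of expectations.\<close>

lemma set_integral_diff_past:
  assumes J: "J \<subseteq> \<Q>" and Q: "Q \<in> \<Q>" "Q \<notin> J" "x \<in> Q" and X: "X \<in> sets (past J)"
  shows "(\<integral>\<omega>\<in>X. f \<omega> x - g \<omega> x \<partial>M) = 0"
proof -
  have finJ: "finite J" using J fin by (rule finite_subset)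
  note sub = past_subalgebra[OF finJ]
  have int: "integrable M (\<lambda>\<omega>. f \<omega> x - g \<omega> x)"
    using integrable_f integrable_g by auto
  have sint: "set_integrable M Y (\<lambda>\<omega>. f \<omega> x - g \<omega> x)" if "Y \<in> sets M" for Y
    unfolding set_integrable_def using integrable_mult_indicator[OF that int] .
  have sintf: "set_integrable M Y (\<lambda>\<omega>. f \<omega> x)" if "Y \<in> sets M" for Y
    unfolding set_integrable_def using integrable_mult_indicator[OF that integrable_f] .
  have sintg: "set_integrable M Y (\<lambda>\<omega>. g \<omega> x)" if "Y \<in> sets M" for Y
    unfolding set_integrable_def using integrable_mult_indicator[OF that integrable_g] .
  have gen: "(\<integral>\<omega>\<in>Y. f \<omega> x - g \<omega> x \<partial>M) = 0" if "Y \<in> past_gen J" for Y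
  proof -
    have YM: "Y \<in> sets M" using that past_gen_sets[OF finJ] by auto
    show ?thesis
      using set_integral_diff_past_gen[OF J Q that] set_integral_diff(2)[OF sintf[OF YM] sintg[OF YM]]
      by simp
  qed
  have pastM: "Y \<in> sets M" if "Y \<in> sigma_sets (space M) (past_gen J)" for Y
    using that sub by (auto simp: subalgebra_def sets_past)
  have "X \<in> sigma_sets (space M) (past_gen J)" using X by (simp add: sets_past)
  with Int_stable_past_gen past_gen_Pow show ?thesis
  proof (induction rule: sigma_sets_induct_disjoint)
    case (basic Y)
    then show ?case by (rule gen)
  next
    case empty
    show ?case by (simp add: set_lebesgue_integral_def)
  next
    case (compl Y)
    have YM: "Y \<in> sets M" by (rule pastM[OF compl(1)])
    have "(\<integral>\<omega>\<in>(space M - Y) \<union> Y. f \<omega> x - g \<omega> x \<partial>M)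
        = (\<integral>\<omega>\<in>(space M - Y). f \<omega> x - g \<omega> x \<partial>M) + (\<integral>\<omega>\<in>Y. f \<omega> x - g \<omega> x \<partial>M)"
      by (rule set_integral_Un) (use YM sint in auto)
    moreover have "(space M - Y) \<union> Y = space M" using sets.sets_into_space[OF YM] by auto
    moreover have "(\<integral>\<omega>\<in>space M. f \<omega> x - g \<omega> x \<partial>M) = 0"
    proof -
      have "(\<integral>\<omega>\<in>space M. f \<omega> x - g \<omega> x \<partial>M) = (\<integral>\<omega>. f \<omega> x \<partial>M) - (\<integral>\<omega>. g \<omega> x \<partial>M)"
        using int integrable_f integrable_g by (simp add: set_integral_space)
      also have "(\<integral>\<omega>. g \<omega> x \<partial>M) = (\<integral>\<omega>. real_cond_exp M G (\<lambda>\<omega>. f \<omega> x) \<omega> \<partial>M)"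
        using mart[of x] by (intro integral_cong_AE) (auto elim!: eventually_mono)
      also have "\<dots> = (\<integral>\<omega>. f \<omega> x \<partial>M)" by (rule G.real_cond_exp_int(2)[OF integrable_f])
      finally show ?thesis by simp
    qed
    ultimately show ?case using compl(2) by simp
  next
    case (union Y)
    have YM: "Y i \<in> sets M" for i using pastM union(2) by auto
    have "(\<integral>\<omega>\<in>(\<Union>i. Y i). f \<omega> x - g \<omega> x \<partial>M) = (\<Sum>i. \<integral>\<omega>\<in>Y i. f \<omega> x - g \<omega> x \<partial>M)"
      by (rule lebesgue_integral_countable_add)
        (use YM union(1) sint in \<open>auto simp: disjoint_family_on_def\<close>)
    then show ?case by (simp add: union(3))
  qed
qed

section \<open>Martingale differences over single cubes\<close>

definition incr :: "'a set \<Rightarrow> 'w \<Rightarrow> real" where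
  "incr Q \<omega> = (\<integral>x. indicator Q x * (f \<omega> x - g \<omega> x) \<partial>N)"

text \<open>Carries the factor \<open>K\<close> so that it bounds the increment over
  \<open>Q\<close> directly; being \<open>G\<close>-measurable, it can enter a compensator.\<close>

definition mass :: "'a set \<Rightarrow> 'w \<Rightarrow> real" where
  "mass Q \<omega> = K * (\<integral>x. indicator Q x * g \<omega> x \<partial>N)"

lemma sec_N: 
  assumes "\<omega> \<in> space M"
  shows f_sec_N: "f \<omega> \<in> borel_measurable N" and g_sec_N: "g \<omega> \<in> borel_measurable N"
proof -
  have "(\<lambda>x. (\<omega>, x)) \<in> measurable N (M \<Otimes>\<^sub>M N)" by (rule measurable_Pair1'[OF assms])
  from measurable_compose[OF this f_meas] measurable_compose[OF this g_meas_M]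
  show "f \<omega> \<in> borel_measurable N" "g \<omega> \<in> borel_measurable N" by simp_all
qed

lemma B_nonneg: "0 \<le> B"
proof -
  obtain \<omega> where "\<omega> \<in> space M" using not_empty by auto
  then show ?thesis using g_le[of \<omega>] g_nonneg[of \<omega>] order_trans by blast
qed

lemma integrable_sec:
  assumes "\<omega> \<in> space M" 
  shows integrable_f_sec: "integrable N (f \<omega>)" and integrable_g_sec: "integrable N (g \<omega>)"
  by (rule N.integrable_const_bound[of _ "K * B"], simp add: f_bound[OF assms], rule f_sec_N[OF assms])
    (rule N.integrable_const_bound[of _ B], simp add: g_bound[OF assms], rule g_sec_N[OF assms])

lemma integrable_ind:
  assumes "Q \<in> \<Q>" "integrable N h"
  shows "integrable N (\<lambda>x. indicator Q x * h x :: real)"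
  using integrable_real_mult_indicator[OF \<Q>_sets[OF assms(1)] assms(2)] by (simp add: mult.commute)

lemma abs_incr_le:
  assumes Q: "Q \<in> \<Q>" and w: "\<omega> \<in> space M"
  shows "\<bar>incr Q \<omega>\<bar> \<le> mass Q \<omega>"
proof -
  have i: "integrable N (\<lambda>x. f \<omega> x - g \<omega> x)" using integrable_sec[OF w] by auto
  have "\<bar>incr Q \<omega>\<bar> \<le> (\<integral>x. \<bar>indicator Q x * (f \<omega> x - g \<omega> x)\<bar> \<partial>N)"
    unfolding incr_def by (rule integral_abs_bound)
  also have "\<dots> \<le> (\<integral>x. K * (indicator Q x * g \<omega> x) \<partial>N)"
  proof (rule integral_mono)
    show "integrable N (\<lambda>x. \<bar>indicator Q x * (f \<omega> x - g \<omega> x)\<bar>)"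
      using integrable_ind[OF Q i] by (rule integrable_abs)
    show "integrable N (\<lambda>x. K * (indicator Q x * g \<omega> x))"
      using integrable_ind[OF Q integrable_g_sec[OF w]] by auto
    show "\<bar>indicator Q x * (f \<omega> x - g \<omega> x)\<bar> \<le> K * (indicator Q x * g \<omega> x)" for x
      using diff_bound[OF w, of x] by (auto simp: indicator_def)
  qed
  finally show ?thesis by (simp add: mass_def)
qed

text \<open>Disjointness of the cubes. Together with a bound \<open>a\<close> on each single mass,
  this makes the sum of the squared increments at most \<open>a * K\<close> times the integral of
  \<open>g\<close>, hence linear in that integral.\<close>

lemma sum_mass_le:
  assumes w: "\<omega> \<in> space M"
  shows "(\<Sum>Q\<in>\<Q>. mass Q \<omega>) \<le> K * (\<integral>x. g \<omega> x \<partial>N)"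
proof -
  have "(\<Sum>Q\<in>\<Q>. mass Q \<omega>) = K * (\<integral>x. (\<Sum>Q\<in>\<Q>. indicator Q x * g \<omega> x) \<partial>N)"
    unfolding mass_def using integrable_ind[OF _ integrable_g_sec[OF w]]
    by (simp add: sum_distrib_left Bochner_Integration.integral_sum)
  also have "(\<integral>x. (\<Sum>Q\<in>\<Q>. indicator Q x * g \<omega> x) \<partial>N) \<le> (\<integral>x. g \<omega> x \<partial>N)"
  proof (rule integral_mono)
    show "integrable N (\<lambda>x. \<Sum>Q\<in>\<Q>. indicator Q x * g \<omega> x)"
      using integrable_ind[OF _ integrable_g_sec[OF w]] by auto
    show "integrable N (g \<omega>)" by (rule integrable_g_sec[OF w])
    show "(\<Sum>Q\<in>\<Q>. indicator Q x * g \<omega> x) \<le> g \<omega> x" for x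
    proof -
      have "(\<Sum>Q\<in>\<Q>. indicator Q x) = (indicator (\<Union>Q\<in>\<Q>. Q) x :: real)"
        using disj fin by (intro indicator_UN_disjoint[symmetric])
          (auto simp: disjoint_def disjoint_family_on_def)
      then have "(\<Sum>Q\<in>\<Q>. indicator Q x * g \<omega> x) = indicator (\<Union>Q\<in>\<Q>. Q) x * g \<omega> x"
        by (simp add: sum_distrib_right[symmetric])
      also have "\<dots> \<le> g \<omega> x" using g_nonneg[OF w, of x] by (auto simp: indicator_def)
      finally show ?thesis .
    qed
  qed
  finally show ?thesis using K by simp
qed

lemma mass_nonneg: "\<omega> \<in> space M \<Longrightarrow> 0 \<le> mass Q \<omega>"
  using K g_nonneg unfolding mass_def by (intro mult_nonneg_nonneg integral_nonneg) auto

lemma mass_bounded: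
  assumes Q: "Q \<in> \<Q>" and w: "\<omega> \<in> space M"
  shows "mass Q \<omega> \<le> K * (B * measure N (space N))"
proof -
  have "(\<integral>x. indicator Q x * g \<omega> x \<partial>N) \<le> (\<integral>x. B \<partial>N)"
    using integrable_ind[OF Q integrable_g_sec[OF w]] g_le[OF w] B_nonneg
    by (intro integral_mono) (auto simp: indicator_def)
  then show ?thesis using K by (auto simp: mass_def mult.commute)
qed

lemma incr_meas[measurable]: "Q \<in> \<Q> \<Longrightarrow> incr Q \<in> borel_measurable M"
  unfolding incr_def by measurable

lemma mass_meas_G[measurable]: "Q \<in> \<Q> \<Longrightarrow> mass Q \<in> borel_measurable G"
  unfolding mass_def by measurable

lemma mass_meas[measurable]: "Q \<in> \<Q> \<Longrightarrow> mass Q \<in> borel_measurable M"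
  by (rule measurable_from_subalg[OF G mass_meas_G])

text \<open>Equality is almost sure because \<open>past J\<close> is built from values of
  \<open>f\<close> at points. The integral of \<open>g\<close> is \<open>G\<close>-measurable
  outright, since \<open>g\<close> is jointly measurable over \<open>G\<close>.\<close>

lemma incr_AE_past:
  assumes J: "J \<subseteq> \<Q>" and Q: "Q \<in> J"
  shows "\<exists>Z\<in>borel_measurable (past J). AE \<omega> in M. Z \<omega> = incr Q \<omega>"
proof -
  have [measurable]: "Q \<in> sets N" using J Q \<Q>_sets by auto
  have Q': "Q \<in> \<Q>" using J Q by auto
  have "\<exists>Z\<in>borel_measurable (past J). AE \<omega> in M. Z \<omega> = (\<integral>x. indicator Q x * f \<omega> x \<partial>N)"
  proof (rule parametric_integral_AE_measurable[where B = "K * B"])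
    show "finite_measure M" "finite_measure N" by unfold_locales
    show "subalgebra M (past J)" using J fin by (intro past_subalgebra) (rule finite_subset)
    show "(\<lambda>(\<omega>, x). indicator Q x * f \<omega> x) \<in> borel_measurable (M \<Otimes>\<^sub>M N)" by measurable
    show "\<bar>indicator Q x * f \<omega> x\<bar> \<le> K * B" if "\<omega> \<in> space M" for \<omega> x
      using f_bound[OF that, of x] by (auto simp: indicator_def)
    show "(\<lambda>\<omega>. indicator Q x * f \<omega> x) \<in> borel_measurable (past J)" for x
      using f_meas_past[OF _ Q, of x] by (cases "x \<in> Q") auto
  qed
  then obtain Z where Z: "Z \<in> borel_measurable (past J)"
    "AE \<omega> in M. Z \<omega> = (\<integral>x. indicator Q x * f \<omega> x \<partial>N)" by auto
  have "(\<lambda>\<omega>. \<integral>x. indicator Q x * g \<omega> x \<partial>N) \<in> borel_measurable G" by measurable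
  then have "(\<lambda>\<omega>. Z \<omega> - (\<integral>x. indicator Q x * g \<omega> x \<partial>N)) \<in> borel_measurable (past J)"
    by (intro borel_measurable_diff Z(1) G_meas_past)
  moreover have "AE \<omega> in M. Z \<omega> - (\<integral>x. indicator Q x * g \<omega> x \<partial>N) = incr Q \<omega>"
    using Z(2) AE_space
  proof eventually_elim
    case (elim \<omega>)
    show ?case
      unfolding elim(1) incr_def right_diff_distrib
      by (rule Bochner_Integration.integral_diff[symmetric])
        (rule integrable_ind[OF Q' integrable_f_sec[OF elim(2)]], rule integrable_ind[OF Q' integrable_g_sec[OF elim(2)]])
  qed
  ultimately show ?thesis 
    by (intro bexI[where x = "\<lambda>\<omega>. Z \<omega> - (\<integral>x. indicator Q x * g \<omega> x \<partial>N)"])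
qed

lemma incr_bounded:
  assumes "Q \<in> \<Q>" "\<omega> \<in> space M"
  shows "\<bar>incr Q \<omega>\<bar> \<le> K * (B * measure N (space N))"
  using abs_incr_le[OF assms] mass_bounded[OF assms] by linarith

lemma integrable_incr: "Q \<in> \<Q> \<Longrightarrow> integrable M (incr Q)"
  by (rule integrable_const_bound[of _ "K * (B * measure N (space N))"]) (auto simp: incr_bounded)

text \<open>Fubini reduces the integral over a set of \<open>past J\<close> to the pointwise
  statement at each \<open>x\<close> of \<open>Q\<close>, so independence of the integrals
  themselves is never invoked.\<close>

lemma cond_exp_incr_past:
  assumes J: "J \<subseteq> \<Q>" and Q: "Q \<in> \<Q>" "Q \<notin> J"
  shows "AE \<omega> in M. real_cond_exp M (past J) (incr Q) \<omega> = 0"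
proof -
  have sub: "subalgebra M (past J)" using J fin by (intro past_subalgebra) (rule finite_subset)
  interpret S: finite_measure_subalgebra M "past J" by unfold_locales (fact sub)
  interpret PF: finite_measure "M \<Otimes>\<^sub>M N"
    by (rule finite_measure_pair_measure) unfold_locales
  have [measurable]: "Q \<in> sets N" using Q \<Q>_sets by auto
  show ?thesis
  proof (rule S.real_cond_exp_charact)
    fix A assume A: "A \<in> sets (past J)"
    then have [measurable]: "A \<in> sets M" using sub by (auto simp: subalgebra_def)
    have "(\<integral>\<omega>\<in>A. incr Q \<omega> \<partial>M) = (\<integral>\<omega>. (\<integral>x. indicator A \<omega> * (indicator Q x * (f \<omega> x - g \<omega> x)) \<partial>N) \<partial>M)"
      by (simp add: set_lebesgue_integral_def incr_def)
    also have "\<dots> = (\<integral>x. (\<integral>\<omega>. indicator A \<omega> * (indicator Q x * (f \<omega> x - g \<omega> x)) \<partial>M) \<partial>N)"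
    proof (rule P.Fubini_integral[symmetric])
      show "integrable (M \<Otimes>\<^sub>M N) (\<lambda>(\<omega>, x). indicator A \<omega> * (indicator Q x * (f \<omega> x - g \<omega> x)))"
      proof (rule PF.integrable_const_bound[of _ "K * B"])
        show "AE p in M \<Otimes>\<^sub>M N. norm (case p of (\<omega>, x) \<Rightarrow> indicator A \<omega> * (indicator Q x * (f \<omega> x - g \<omega> x))) \<le> K * B"
        proof (intro AE_I2)
          fix p assume "p \<in> space (M \<Otimes>\<^sub>M N)"
          then obtain \<omega> x where p: "p = (\<omega>, x)" "\<omega> \<in> space M" by (auto simp: space_pair_measure)
          have "\<bar>f \<omega> x - g \<omega> x\<bar> \<le> K * B"
            using diff_bound[OF p(2), of x] mult_left_mono[OF g_le[OF p(2), of x], of K] K by linarith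
          moreover have "0 \<le> K * B" using K B_nonneg by simp
          ultimately show "norm (case p of (\<omega>, x) \<Rightarrow> indicator A \<omega> * (indicator Q x * (f \<omega> x - g \<omega> x))) \<le> K * B"
            by (auto simp: p indicator_def)
        qed
      qed measurable
    qed
    also have "\<dots> = (\<integral>x. 0 \<partial>N)"
    proof (intro Bochner_Integration.integral_cong refl)
      fix x
      show "(\<integral>\<omega>. indicator A \<omega> * (indicator Q x * (f \<omega> x - g \<omega> x)) \<partial>M) = 0"
      proof (cases "x \<in> Q")
        case True
        then show ?thesis
          using set_integral_diff_past[OF J Q True A] by (simp add: set_lebesgue_integral_def)
      qed simp
    qed
    finally show "(\<integral>\<omega>\<in>A. incr Q \<omega> \<partial>M) = (\<integral>\<omega>\<in>A. 0 \<partial>M)" by (simp add: set_lebesgue_integral_def)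
  qed (use Q in \<open>auto intro: integrable_incr\<close>)
qed

text \<open>Two functions occur because the weight \<open>\<Psi>\<close> met below is built from
  increments over earlier cubes, which agree with \<open>past J\<close>-measurable functions only
  almost everywhere; \<open>Z\<close> is such a version, and \<open>\<Psi>\<close> carries the
  bound.\<close>

lemma incr_orthogonal:
  assumes J: "J \<subseteq> \<Q>" and Q: "Q \<in> \<Q>" "Q \<notin> J"
    and Z[measurable]: "Z \<in> borel_measurable (past J)" 
    and Psi[measurable]: "\<Psi> \<in> borel_measurable M"
    and eq: "AE \<omega> in M. Z \<omega> = \<Psi> \<omega>"
    and bd: "\<And>\<omega>. \<omega> \<in> space M \<Longrightarrow> \<bar>\<Psi> \<omega>\<bar> \<le> c"
  shows "integrable M (\<lambda>\<omega>. \<Psi> \<omega> * incr Q \<omega>)" "(\<integral>\<omega>. \<Psi> \<omega> * incr Q \<omega> \<partial>M) = 0"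
proof -
  note [measurable] = incr_meas[OF Q(1)]
  have sub: "subalgebra M (past J)" using J fin by (intro past_subalgebra) (rule finite_subset)
  interpret S: finite_measure_subalgebra M "past J" by unfold_locales (fact sub)
  have ZM[measurable]: "Z \<in> borel_measurable M" by (rule measurable_from_subalg[OF sub Z])
  show int: "integrable M (\<lambda>\<omega>. \<Psi> \<omega> * incr Q \<omega>)"
    by (rule integrable_const_bound[of _ "c * (K * (B * measure N (space N)))"])
      (auto simp: abs_mult intro!: mult_mono bd incr_bounded Q order_trans[OF abs_ge_zero bd])
  have "integrable M (\<lambda>\<omega>. Z \<omega> * incr Q \<omega>)"
    by (rule integrable_cong_AE_imp[OF int]) (use eq in \<open>auto elim!: eventually_mono\<close>)
  then have "(\<integral>\<omega>. Z \<omega> * incr Q \<omega> \<partial>M) = (\<integral>\<omega>. Z \<omega> * real_cond_exp M (past J) (incr Q) \<omega> \<partial>M)"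
    by (intro S.real_cond_exp_intg(2)[symmetric]) auto
  also have "\<dots> = (\<integral>\<omega>. 0 \<partial>M)"
    using cond_exp_incr_past[OF J Q] by (intro integral_cong_AE) (auto elim!: eventually_mono)
  finally have "(\<integral>\<omega>. Z \<omega> * incr Q \<omega> \<partial>M) = 0" by simp
  moreover have "(\<integral>\<omega>. Z \<omega> * incr Q \<omega> \<partial>M) = (\<integral>\<omega>. \<Psi> \<omega> * incr Q \<omega> \<partial>M)"
    using eq by (intro integral_cong_AE) (auto elim!: eventually_mono)
  ultimately show "(\<integral>\<omega>. \<Psi> \<omega> * incr Q \<omega> \<partial>M) = 0" by simp
qed

text \<open>The weight \<open>W\<close> is random, but known at the earlier time; this allows normalising by \<open>1 + Y\<^sub>n\<close> below.\<close>

lemma exponential_supermartingale: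
  assumes W[measurable]: "W \<in> borel_measurable G"
    and Ww: "\<And>\<omega>. \<omega> \<in> space M \<Longrightarrow> \<bar>W \<omega>\<bar> \<le> w"
    and a: "0 \<le> a" "w * a \<le> 1"
    and mass: "AE \<omega> in M. \<forall>Q\<in>\<Q>. mass Q \<omega> \<le> a"
    and J: "J \<subseteq> \<Q>"
  defines "\<Phi> \<equiv> \<lambda>J \<omega>. exp (\<Sum>Q\<in>J. W \<omega> * incr Q \<omega> - (W \<omega>)\<^sup>2 * a * mass Q \<omega>)"
  shows "integrable M (\<Phi> J) \<and> (\<integral>\<omega>. \<Phi> J \<omega> \<partial>M) \<le> 1"
proof -
  have [measurable]: "W \<in> borel_measurable M" by (rule measurable_from_subalg[OF G W])
  define c where "c = K * (B * measure N (space N))"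
  have c0: "0 \<le> c" using K B_nonneg by (simp add: c_def)
  have w0: "0 \<le> w" using Ww not_empty by (metis abs_ge_zero all_not_in_conv order_trans)
  have Phi_meas: "\<Phi> J \<in> borel_measurable M" if "J \<subseteq> \<Q>" for J
  proof -
    have [measurable]: "incr Q \<in> borel_measurable M" "mass Q \<in> borel_measurable M" if "Q \<in> J" for Q
      using that \<open>J \<subseteq> \<Q>\<close> by (auto intro: incr_meas mass_meas)
    show ?thesis unfolding \<Phi>_def by measurable
  qed
  have Phi_bd: "\<bar>\<Phi> J \<omega>\<bar> \<le> exp (card J * (w * c))" if "J \<subseteq> \<Q>" "\<omega> \<in> space M" for J \<omega>
  proof -
    have "(\<Sum>Q\<in>J. W \<omega> * incr Q \<omega> - (W \<omega>)\<^sup>2 * a * mass Q \<omega>) \<le> (\<Sum>Q\<in>J. w * c)"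
    proof (rule sum_mono)
      fix Q assume "Q \<in> J"
      with that have Q: "Q \<in> \<Q>" by auto
      have "W \<omega> * incr Q \<omega> \<le> \<bar>W \<omega>\<bar> * \<bar>incr Q \<omega>\<bar>" by (simp add: abs_mult[symmetric])
      also have "\<dots> \<le> w * c"
        using Ww[OF that(2)] incr_bounded[OF Q that(2)] w0 by (intro mult_mono) (auto simp: c_def)
      finally have "W \<omega> * incr Q \<omega> \<le> w * c" .
      moreover have "0 \<le> (W \<omega>)\<^sup>2 * a * mass Q \<omega>"
        using a mass_nonneg[OF that(2), of Q] by auto
      ultimately show "W \<omega> * incr Q \<omega> - (W \<omega>)\<^sup>2 * a * mass Q \<omega> \<le> w * c" by linarith
    qed
    then show ?thesis by (simp add: \<Phi>_def)
  qed
  have Phi_int: "integrable M (\<Phi> J)" if "J \<subseteq> \<Q>" for J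
    by (rule integrable_const_bound[of _ "exp (card J * (w * c))"])
      (use Phi_bd[OF that] Phi_meas[OF that] in auto)
  have "finite J" using J fin by (rule finite_subset)
  then have "(\<integral>\<omega>. \<Phi> J \<omega> \<partial>M) \<le> 1" using J
  proof (induction J)
    case empty
    then show ?case by (simp add: \<Phi>_def prob_space)
  next
    case (insert Q J)
    have J: "J \<subseteq> \<Q>" and Q: "Q \<in> \<Q>" using insert by auto
    note [measurable] = Phi_meas[OF J] incr_meas[OF Q] mass_meas[OF Q] mass_meas_G[OF Q]
    \<comment> \<open>The coefficient of \<open>incr Q\<close> in the bound on
      \<open>\<Phi> (insert Q J)\<close> below. The factor with \<open>mass Q\<close> is
      \<open>G\<close>-measurable, so \<open>\<Psi>\<close> is, up to null sets,
      \<open>past J\<close>-measurable and the linear term integrates to zero.\<close>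
    define \<Psi> where "\<Psi> = (\<lambda>\<omega>. \<Phi> J \<omega> * (W \<omega> * exp (- ((W \<omega>)\<^sup>2 * a * mass Q \<omega>))))"
    have "\<forall>Q\<in>J. \<exists>Z\<in>borel_measurable (past J). AE \<omega> in M. Z \<omega> = incr Q \<omega>"
      using incr_AE_past[OF J] by blast
    then obtain Z where Z: "\<And>Q. Q \<in> J \<Longrightarrow> Z Q \<in> borel_measurable (past J)"
      "\<And>Q. Q \<in> J \<Longrightarrow> AE \<omega> in M. Z Q \<omega> = incr Q \<omega>" by metis
    define \<Psi>' where "\<Psi>' = (\<lambda>\<omega>. exp (\<Sum>Q\<in>J. W \<omega> * Z Q \<omega> - (W \<omega>)\<^sup>2 * a * mass Q \<omega>)
       * (W \<omega> * exp (- ((W \<omega>)\<^sup>2 * a * mass Q \<omega>))))"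
    have \<Psi>'_meas: "\<Psi>' \<in> borel_measurable (past J)"
    proof -
      have [measurable]: "W \<in> borel_measurable (past J)" by (rule G_meas_past[OF W])
      have [measurable]: "mass Q \<in> borel_measurable (past J)" if "Q \<in> \<Q>" for Q
        by (rule G_meas_past[OF mass_meas_G[OF that]])
      have mJ[measurable]: "mass Q \<in> borel_measurable (past J)" if "Q \<in> J" for Q
        using that J by auto
      note [measurable] = Z(1) Q
      show ?thesis unfolding \<Psi>'_def by measurable
    qed
    have eq: "AE \<omega> in M. \<Psi>' \<omega> = \<Psi> \<omega>"
    proof -
      have "AE \<omega> in M. \<forall>Q\<in>J. Z Q \<omega> = incr Q \<omega>"
        using Z(2) insert(1) by (intro AE_finite_allI) auto
      then show ?thesis
        by eventually_elim (simp add: \<Psi>'_def \<Psi>_def \<Phi>_def)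
    qed
    have \<Psi>_meas: "\<Psi> \<in> borel_measurable M" unfolding \<Psi>_def by measurable
    have \<Psi>_bd: "\<bar>\<Psi> \<omega>\<bar> \<le> exp (card J * (w * c)) * w" if w: "\<omega> \<in> space M" for \<omega>
    proof -
      have "exp (- ((W \<omega>)\<^sup>2 * a * mass Q \<omega>)) \<le> 1"
        using a mass_nonneg[OF w, of Q] by auto
      then have "\<bar>W \<omega>\<bar> * exp (- ((W \<omega>)\<^sup>2 * a * mass Q \<omega>)) \<le> w * 1"
        using Ww[OF w] w0 by (intro mult_mono) auto
      then show ?thesis
        using Phi_bd[OF J w] w0 unfolding \<Psi>_def abs_mult by (intro mult_mono) auto
    qed
    note orth = incr_orthogonal[OF J Q insert(2) \<Psi>'_meas \<Psi>_meas eq \<Psi>_bd]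
    have "(\<integral>\<omega>. \<Phi> (insert Q J) \<omega> \<partial>M) \<le> (\<integral>\<omega>. \<Phi> J \<omega> + \<Psi> \<omega> * incr Q \<omega> \<partial>M)"
    proof (rule integral_mono_AE)
      show "integrable M (\<Phi> (insert Q J))" using insert by (intro Phi_int) auto
      show "integrable M (\<lambda>\<omega>. \<Phi> J \<omega> + \<Psi> \<omega> * incr Q \<omega>)" using Phi_int[OF J] orth(1) by auto
      show "AE \<omega> in M. \<Phi> (insert Q J) \<omega> \<le> \<Phi> J \<omega> + \<Psi> \<omega> * incr Q \<omega>"
        using mass AE_space
      proof eventually_elim
        case (elim \<omega>)
        define y where "y = W \<omega> * incr Q \<omega>"
        define u where "u = (W \<omega>)\<^sup>2 * a * mass Q \<omega>"
        have X: "\<bar>incr Q \<omega>\<bar> \<le> mass Q \<omega>" "mass Q \<omega> \<le> a" "0 \<le> mass Q \<omega>"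
          using abs_incr_le[OF Q elim(2)] elim(1) Q mass_nonneg[OF elim(2)] by auto
        have "\<bar>y\<bar> \<le> w * a"
          unfolding y_def abs_mult using X Ww[OF elim(2)] w0 by (intro mult_mono) auto
        then have y1: "\<bar>y\<bar> \<le> 1" using a by linarith
        \<comment> \<open>One factor is bounded by \<open>a\<close>, the other only by
          \<open>mass Q\<close>, so that the compensators add up to a multiple of the total
          mass.\<close>
        have "(incr Q \<omega>)\<^sup>2 \<le> a * mass Q \<omega>"
        proof -
          have "\<bar>incr Q \<omega>\<bar> * \<bar>incr Q \<omega>\<bar> \<le> a * mass Q \<omega>" using X by (intro mult_mono) auto
          then show ?thesis by (simp add: power2_eq_square)
        qed
        then have y2: "y\<^sup>2 \<le> u"
          unfolding y_def u_def by (simp add: power_mult_distrib mult.assoc mult_left_mono)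
        have "exp (y - u) = exp y * exp (- u)" by (simp add: exp_add[symmetric])
        \<comment> \<open>The compensator swallows the quadratic term, as
          \<open>y\<^sup>2 \<le> u\<close>, and \<open>(1 + u) * exp (- u)\<close> is at most 1.
          What survives is linear in \<open>incr Q\<close>.\<close>
        also have "\<dots> \<le> (1 + y + u) * exp (- u)"
          using exp_le_one_plus_quadratic[OF y1] y2 by (intro mult_right_mono) auto
        also have "\<dots> = (1 + u) * exp (- u) + y * exp (- u)" by (simp add: algebra_simps)
        also have "(1 + u) * exp (- u) \<le> exp u * exp (- u)"
          using exp_ge_add_one_self[of u] by (intro mult_right_mono) auto
        also have "exp u * exp (- u) = 1" by (simp add: exp_add[symmetric])
        finally have step: "exp (y - u) \<le> 1 + y * exp (- u)" by simp
        have "\<Phi> (insert Q J) \<omega> = \<Phi> J \<omega> * exp (y - u)"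
          using insert by (simp add: \<Phi>_def y_def u_def exp_add[symmetric] add.commute)
        also have "\<dots> \<le> \<Phi> J \<omega> * (1 + y * exp (- u))"
          using step by (intro mult_left_mono) (auto simp: \<Phi>_def)
        finally show ?case by (simp add: \<Psi>_def y_def u_def algebra_simps)
      qed
    qed
    also have "\<dots> = (\<integral>\<omega>. \<Phi> J \<omega> \<partial>M)" using Phi_int[OF J] orth by simp
    finally show ?case using insert.IH[OF J] by linarith
  qed
  then show ?thesis using Phi_int[OF J] by blast
qed

lemma total_meas_G: "(\<lambda>\<omega>. \<integral>x. g \<omega> x \<partial>N) \<in> borel_measurable G"
  by measurable

text \<open>Markov's inequality for the exponentials with weights l/(1 + Y) and -l/(1 + Y), where Y
  is the integral of \<open>g\<close>. The normalisation bounds the compensator by a constant, since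
  the masses sum to at most K Y and Y <= (1 + Y)^2; the two signs account for the factor 2.\<close>

lemma tail_bound:
  assumes a: "0 \<le> a" "l * a \<le> 1" and l: "0 \<le> l"
    and mass: "AE \<omega> in M. \<forall>Q\<in>\<Q>. mass Q \<omega> \<le> a"
  shows "prob {\<omega>\<in>space M. k * (1 + (\<integral>x. g \<omega> x \<partial>N)) \<le> \<bar>\<Sum>Q\<in>\<Q>. incr Q \<omega>\<bar>}
           \<le> 2 * exp (l\<^sup>2 * a * K - l * k)"
proof -
  define Y where "Y \<omega> = (\<integral>x. g \<omega> x \<partial>N)" for \<omega>
  have Y_G[measurable]: "Y \<in> borel_measurable G" unfolding Y_def by (rule total_meas_G)
  have [measurable]: "Y \<in> borel_measurable M" by (rule measurable_from_subalg[OF G Y_G])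
  have Y0: "0 \<le> Y \<omega>" if "\<omega> \<in> space M" for \<omega>
    unfolding Y_def using g_nonneg[OF that] by simp
  define \<Phi> where "\<Phi> \<sigma> \<omega> = exp (\<Sum>Q\<in>\<Q>. \<sigma> * l / (1 + Y \<omega>) * incr Q \<omega> - (\<sigma> * l / (1 + Y \<omega>))\<^sup>2 * a * mass Q \<omega>)" for \<sigma> \<omega>
  have \<Phi>: "integrable M (\<Phi> \<sigma>)" "(\<integral>\<omega>. \<Phi> \<sigma> \<omega> \<partial>M) \<le> 1" if \<sigma>: "\<bar>\<sigma>\<bar> = 1" for \<sigma>
  proof -
    have "\<bar>\<sigma> * l / (1 + Y \<omega>)\<bar> \<le> l" if "\<omega> \<in> space M" for \<omega>
      using Y0[OF that] l by (simp add: abs_mult \<sigma> divide_le_eq mult_le_cancel_left1)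
    then have "integrable M (\<Phi> \<sigma>) \<and> (\<integral>\<omega>. \<Phi> \<sigma> \<omega> \<partial>M) \<le> 1"
      unfolding \<Phi>_def by (intro exponential_supermartingale[where w = l] a mass) auto
    then show "integrable M (\<Phi> \<sigma>)" "(\<integral>\<omega>. \<Phi> \<sigma> \<omega> \<partial>M) \<le> 1" by auto
  qed
  define S where "S \<omega> = (\<Sum>Q\<in>\<Q>. incr Q \<omega>)" for \<omega>
  \<comment> \<open>The level that one of the two exponentials reaches on the event: the deviation
    contributes at least \<open>l * k\<close>, and the compensator costs at most
    \<open>l\<^sup>2 * a * K\<close>.\<close>
  define e where "e = exp (l * k - l\<^sup>2 * a * K)"
  have \<Phi>_ge: "exp (\<sigma> * l * S \<omega> / (1 + Y \<omega>) - l\<^sup>2 * a * K) \<le> \<Phi> \<sigma> \<omega>"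
    if \<sigma>: "\<bar>\<sigma>\<bar> = 1" and w: "\<omega> \<in> space M" for \<sigma> \<omega>
  proof -
    have \<sigma>2: "\<sigma>\<^sup>2 = 1" using \<sigma> by (metis power2_abs power_one)
    have "(\<sigma> * l / (1 + Y \<omega>))\<^sup>2 * a * (\<Sum>Q\<in>\<Q>. mass Q \<omega>) \<le> (\<sigma> * l / (1 + Y \<omega>))\<^sup>2 * a * (K * Y \<omega>)"
      using sum_mass_le[OF w] a by (intro mult_left_mono) (auto simp: Y_def)
    also have "\<dots> = l\<^sup>2 * a * K * (Y \<omega> / (1 + Y \<omega>)\<^sup>2)"
      by (simp add: power_mult_distrib power_divide \<sigma>2)
    also have "\<dots> \<le> l\<^sup>2 * a * K * 1"
    proof (rule mult_left_mono)
      have "Y \<omega> \<le> 1 * (1 + Y \<omega>)\<^sup>2" using Y0[OF w] by (simp add: power2_eq_square algebra_simps)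
      then show "Y \<omega> / (1 + Y \<omega>)\<^sup>2 \<le> 1" using Y0[OF w] by (simp add: divide_le_eq)
    qed (use a K in auto)
    finally have "(\<sigma> * l / (1 + Y \<omega>))\<^sup>2 * a * (\<Sum>Q\<in>\<Q>. mass Q \<omega>) \<le> l\<^sup>2 * a * K" by simp
    moreover have "(\<Sum>Q\<in>\<Q>. \<sigma> * l / (1 + Y \<omega>) * incr Q \<omega> - (\<sigma> * l / (1 + Y \<omega>))\<^sup>2 * a * mass Q \<omega>)
        = \<sigma> * l / (1 + Y \<omega>) * S \<omega> - (\<sigma> * l / (1 + Y \<omega>))\<^sup>2 * a * (\<Sum>Q\<in>\<Q>. mass Q \<omega>)"
      by (simp only: S_def sum_subtractf sum_distrib_left)
    ultimately show ?thesis by (simp add: \<Phi>_def)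
  qed
  have "prob {\<omega>\<in>space M. k * (1 + Y \<omega>) \<le> \<bar>S \<omega>\<bar>} \<le> prob {\<omega>\<in>space M. e \<le> \<Phi> 1 \<omega> + \<Phi> (- 1) \<omega>}"
  proof (rule finite_measure_mono)
    show "{\<omega>\<in>space M. k * (1 + Y \<omega>) \<le> \<bar>S \<omega>\<bar>} \<subseteq> {\<omega>\<in>space M. e \<le> \<Phi> 1 \<omega> + \<Phi> (- 1) \<omega>}"
    proof safe
      fix \<omega> assume w: "\<omega> \<in> space M" and k: "k * (1 + Y \<omega>) \<le> \<bar>S \<omega>\<bar>"
      obtain \<sigma> :: real where \<sigma>: "\<bar>\<sigma>\<bar> = 1" "\<sigma> = 1 \<or> \<sigma> = - 1" "\<bar>S \<omega>\<bar> = \<sigma> * S \<omega>"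
        by (cases "0 \<le> S \<omega>") (auto intro: that[of 1] that[of "- 1"])
      have "k \<le> \<sigma> * S \<omega> / (1 + Y \<omega>)" using k \<sigma>(3) Y0[OF w] by (simp add: le_divide_eq)
      then have "l * k \<le> \<sigma> * l * S \<omega> / (1 + Y \<omega>)" using mult_left_mono[OF _ l, of k "\<sigma> * S \<omega> / (1 + Y \<omega>)"] by (simp add: mult_ac)
      then have "e \<le> \<Phi> \<sigma> \<omega>" 
        unfolding e_def by (intro order_trans[OF _ \<Phi>_ge[OF \<sigma>(1) w]]) simp
      moreover have "0 \<le> \<Phi> 1 \<omega>" "0 \<le> \<Phi> (- 1) \<omega>" by (auto simp: \<Phi>_def)
      ultimately show "e \<le> \<Phi> 1 \<omega> + \<Phi> (- 1) \<omega>" using \<sigma>(2) by auto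
    qed
    have [measurable]: "\<Phi> 1 \<in> borel_measurable M" "\<Phi> (- 1) \<in> borel_measurable M"
      using \<Phi>(1)[of 1] \<Phi>(1)[of "- 1"] by auto
    show "{\<omega>\<in>space M. e \<le> \<Phi> 1 \<omega> + \<Phi> (- 1) \<omega>} \<in> events" by measurable
  qed
  also have "\<dots> \<le> (\<integral>\<omega>. \<Phi> 1 \<omega> + \<Phi> (- 1) \<omega> \<partial>M) / e"
  proof (rule integral_Markov_inequality_measure[where A = "space M"])
    show "integrable M (\<lambda>\<omega>. \<Phi> 1 \<omega> + \<Phi> (- 1) \<omega>)" using \<Phi>(1)[of 1] \<Phi>(1)[of "- 1"] by auto
  qed (auto simp: e_def \<Phi>_def)
  also have "\<dots> \<le> 2 / e"
    using \<Phi>[of 1] \<Phi>[of "- 1"] by (intro divide_right_mono) (auto simp: e_def)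
  also have "2 / e = 2 * exp (l\<^sup>2 * a * K - l * k)"
    by (simp add: e_def exp_diff)
  finally show ?thesis by (simp add: Y_def S_def)
qed

end

section \<open>Dyadic cubes\<close>

text \<open>In this form the index of the cube is a function of the point, which yields
  disjointness, injectivity and covering at once.\<close>

lemma mem_dyadic_cube: "x \<in> dyadic_cube m k \<longleftrightarrow> (\<forall>i. \<lfloor>x $ i * 2 ^ m\<rfloor> = k i)"
  unfolding dyadic_cube_def floor_eq_iff by (simp add: field_simps)

lemma dyadic_cube_nonempty: "\<exists>x. x \<in> dyadic_cube m k"
  by (rule exI[of _ "\<chi> i. real_of_int (k i) / 2 ^ m"]) (simp add: mem_dyadic_cube)

lemma inj_dyadic_cube: "inj (dyadic_cube m)"
proof (rule injI)
  fix k k' :: "'d::finite \<Rightarrow> int" assume "dyadic_cube m k = dyadic_cube m k'"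
  moreover obtain x where "x \<in> dyadic_cube m k" using dyadic_cube_nonempty[of m k] by blast
  ultimately have "x \<in> dyadic_cube m k" "x \<in> dyadic_cube m k'" by auto
  then show "k = k'" unfolding mem_dyadic_cube by (intro ext) metis
qed

lemma dyadic_cube_borel[measurable]: "dyadic_cube m k \<in> sets borel"
  unfolding dyadic_cube_def by measurable

lemma sum_indicator_dyadic_cube:
  fixes x :: "real^'d"
  assumes "finite I" "(\<lambda>i. \<lfloor>x $ i * 2 ^ m\<rfloor>) \<in> I"
  shows "(\<Sum>k\<in>I. indicator (dyadic_cube m k) x) = (1::real)"
proof -
  define j where "j = (\<lambda>i. \<lfloor>x $ i * 2 ^ m\<rfloor>)"
  have "x \<in> dyadic_cube m k \<longleftrightarrow> k = j" for k
    unfolding mem_dyadic_cube j_def by (auto intro!: ext)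
  then have "indicator (dyadic_cube m k) x = (if k = j then 1 else 0 :: real)" for k
    by (simp add: indicator_def)
  then show ?thesis using assms by (simp add: j_def)
qed

lemma disjoint_dyadic_cubes: "disjoint (dyadic_cube m ` I)"
  by (auto simp: disjoint_def mem_dyadic_cube fun_eq_iff) 

text \<open>Distinct congruent indices differ by at least p in some coordinate; after scaling by 2^m
  the cubes have side one, which leaves a gap of p - 1.\<close>

lemma dyadic_cube_separated:
  fixes k k' :: "'d::finite \<Rightarrow> int" and p :: int
  assumes "k \<noteq> k'" and mod: "\<And>i. k i mod p = k' i mod p" and p: "0 < p"
    and x: "x \<in> dyadic_cube m k" and y: "y \<in> dyadic_cube m k'"
  shows "real_of_int (p - 1) / 2 ^ m \<le> dist x y"
proof -
  obtain i where i: "k i \<noteq> k' i" using \<open>k \<noteq> k'\<close> by auto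
  have "p dvd k i - k' i" using mod[of i] by (simp add: mod_eq_dvd_iff)
  then have "p \<le> \<bar>k i - k' i\<bar>" using i p zdvd_imp_le[of p "\<bar>k i - k' i\<bar>"] by auto
  moreover have "real_of_int (k i) \<le> x $ i * 2 ^ m" "x $ i * 2 ^ m < real_of_int (k i) + 1"
    "real_of_int (k' i) \<le> y $ i * 2 ^ m" "y $ i * 2 ^ m < real_of_int (k' i) + 1"
    using x y unfolding mem_dyadic_cube floor_eq_iff by auto
  ultimately have "real_of_int (p - 1) \<le> \<bar>x $ i * 2 ^ m - y $ i * 2 ^ m\<bar>" by linarith
  also have "\<dots> = \<bar>(x - y) $ i\<bar> * 2 ^ m" by (simp add: left_diff_distrib[symmetric] abs_mult)
  also have "\<dots> \<le> dist x y * 2 ^ m"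
    unfolding dist_norm by (intro mult_right_mono component_le_norm_cart) auto
  finally show ?thesis by (simp add: divide_le_eq)
qed

lemma dyadic_cube_subset_cball:
  fixes k :: "'d::finite \<Rightarrow> int"
  assumes x: "x \<in> dyadic_cube m k"
  shows "dyadic_cube m k \<subseteq> cball x (real CARD('d) / 2 ^ m)"
proof
  fix y assume y: "y \<in> dyadic_cube m k"
  have "\<bar>(x - y) $ i\<bar> \<le> 1 / 2 ^ m" for i
  proof -
    have "real_of_int (k i) \<le> x $ i * 2 ^ m" "x $ i * 2 ^ m < real_of_int (k i) + 1"
      "real_of_int (k i) \<le> y $ i * 2 ^ m" "y $ i * 2 ^ m < real_of_int (k i) + 1"
      using x y unfolding mem_dyadic_cube floor_eq_iff by auto
    then have "\<bar>x $ i * 2 ^ m - y $ i * 2 ^ m\<bar> \<le> 1" by linarith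
    moreover have "x $ i * 2 ^ m - y $ i * 2 ^ m = (x - y) $ i * 2 ^ m" by (simp add: left_diff_distrib)
    ultimately show ?thesis by (simp add: le_divide_eq abs_mult)
  qed
  \<comment> \<open>The Euclidean norm is bounded crudely by the l1 norm; this gives
    \<open>CARD('d)\<close> in place of its square root and only affects constants.\<close>
  then have "(\<Sum>i\<in>UNIV. \<bar>(x - y) $ i\<bar>) \<le> (\<Sum>i\<in>(UNIV::'d set). 1 / 2 ^ m)" by (intro sum_mono) auto
  then show "y \<in> cball x (real CARD('d) / 2 ^ m)"
    using norm_le_l1_cart[of "x - y"] by (simp add: dist_norm)
qed

lemma finite_bounded_index: "finite {k :: 'd::finite \<Rightarrow> int. \<forall>i. k i \<in> {a..b}}"
proof -
  have "{k :: 'd \<Rightarrow> int. \<forall>i. k i \<in> {a..b}} = PiE UNIV (\<lambda>_. {a..b})"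
    by (auto simp: PiE_UNIV_domain)
  then show ?thesis by (auto intro: finite_PiE)
qed

lemma bounded_dyadic_index:
  fixes U :: "(real^'d) set"
  assumes "bounded U"
  obtains R :: int where "\<And>x i. x \<in> U \<Longrightarrow> \<lfloor>x $ i * 2 ^ m\<rfloor> \<in> {- R..R}"
proof -
  obtain r where r: "\<And>x. x \<in> U \<Longrightarrow> norm x \<le> r" using assms unfolding bounded_iff by auto
  have "\<lfloor>x $ i * 2 ^ m\<rfloor> \<in> {- (\<lceil>r * 2 ^ m\<rceil> + 1)..\<lceil>r * 2 ^ m\<rceil> + 1}" if "x \<in> U" for x i
  proof -
    have "\<bar>x $ i\<bar> \<le> r" using component_le_norm_cart[of x i] r[OF that] by linarith
    then have "\<bar>x $ i\<bar> * 2 ^ m \<le> r * 2 ^ m" by (intro mult_right_mono) auto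
    then have "\<bar>x $ i * 2 ^ m\<bar> \<le> r * 2 ^ m" by (simp add: abs_mult)
    then have "x $ i * 2 ^ m \<le> r * 2 ^ m" "- (r * 2 ^ m) \<le> x $ i * 2 ^ m" by linarith+
    then show ?thesis unfolding atLeastAtMost_iff by linarith
  qed
  then show ?thesis by (rule that)
qed

section \<open>From one separated class of cubes to the full increment\<close>

lemma SI_martingaleD:
  assumes "SI_martingale M F \<mu>"
  shows SI_prob_space: "prob_space M"
    and SI_nonneg: "\<forall>n. \<forall>\<omega>\<in>space M. \<forall>x. 0 \<le> \<mu> n \<omega> x"
    and SI_measurable: "\<forall>n. (\<lambda>(\<omega>, x). \<mu> n \<omega> x) \<in> borel_measurable (F n \<Otimes>\<^sub>M lborel)"
    and SI_1: "\<exists>f. (\<forall>\<omega>\<in>space M. \<mu> 0 \<omega> = f) \<and> (\<exists>B. \<forall>x. f x \<le> B) \<and> bounded {x. f x \<noteq> 0}"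
    and SI_subalgebra: "\<forall>n. subalgebra M (F n)"
    and SI_2: "\<forall>n x. AE \<omega> in M. real_cond_exp M (F n) (\<lambda>\<omega>. \<mu> (Suc n) \<omega> x) \<omega> = \<mu> n \<omega> x"
    and SI_3: "\<exists>C. \<forall>n. \<forall>\<omega>\<in>space M. \<forall>x. \<mu> (Suc n) \<omega> x \<le> C * \<mu> n \<omega> x"
    and SI_4: "\<exists>C. \<forall>n. \<forall>\<Q>. \<Q> \<subseteq> range (dyadic_cube (Suc n)) \<longrightarrow> separated_family (C / 2 ^ n) \<Q> \<longrightarrow>
        cond_indep_sets M (F n) (restr_events M (\<mu> (Suc n))) \<Q>"
  using assms unfolding SI_martingale_def by - (elim conjE, assumption)+

text \<open>The product sigma-algebra depends on the second factor only through its measurable sets,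
  so joint measurability over \<open>lborel\<close> passes to every Borel measure, however
  singular.\<close>

lemma SI_joint_measurable:
  assumes SI: "SI_martingale M F \<mu>" and N: "sets N = sets borel"
  shows "(\<lambda>(\<omega>, x). \<mu> n \<omega> x) \<in> borel_measurable (F n \<Otimes>\<^sub>M N)"
    and "(\<lambda>(\<omega>, x). \<mu> n \<omega> x) \<in> borel_measurable (M \<Otimes>\<^sub>M N)"
proof -
  have "sets (F n \<Otimes>\<^sub>M N) = sets (F n \<Otimes>\<^sub>M lborel)"
    by (intro sets_pair_measure_cong) (simp_all add: N)
  then show FN: "(\<lambda>(\<omega>, x). \<mu> n \<omega> x) \<in> borel_measurable (F n \<Otimes>\<^sub>M N)"
    using SI_measurable[OF SI, rule_format, of n]
    by (subst measurable_cong_sets[of "F n \<Otimes>\<^sub>M N" "F n \<Otimes>\<^sub>M lborel" borel borel]) simp_all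
  have sub: "subalgebra M (F n)" by (rule SI_subalgebra[OF SI, rule_format])
  have "(\<lambda>p. (fst p, snd p)) \<in> measurable (M \<Otimes>\<^sub>M N) (F n \<Otimes>\<^sub>M N)"
    by (intro measurable_Pair measurable_compose[OF measurable_fst] measurable_snd
        measurable_from_subalg[OF sub] measurable_ident)
      (use sub in \<open>auto simp: measurable_def subalgebra_def\<close>)
  from measurable_compose[OF this FN] show "(\<lambda>(\<omega>, x). \<mu> n \<omega> x) \<in> borel_measurable (M \<Otimes>\<^sub>M N)"
    by simp
qed

text \<open>Iterate (SI3) from (SI1): the bound grows like K^n, and a point where the initial
  density vanishes stays a zero for all times.\<close>

lemma SI_bounds:
  assumes SI: "SI_martingale M F \<mu>"
  obtains K Bd U where "1 \<le> K" "bounded U"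
    "\<And>n \<omega> x. \<omega> \<in> space M \<Longrightarrow> \<mu> (Suc n) \<omega> x \<le> K * \<mu> n \<omega> x"
    "\<And>n \<omega> x. \<omega> \<in> space M \<Longrightarrow> \<mu> n \<omega> x \<le> Bd n"
    "\<And>n \<omega> x. \<omega> \<in> space M \<Longrightarrow> x \<notin> U \<Longrightarrow> \<mu> n \<omega> x = 0"
proof -
  have nn: "\<And>n \<omega> x. \<omega> \<in> space M \<Longrightarrow> 0 \<le> \<mu> n \<omega> x" using SI_nonneg[OF SI] by blast
  obtain c where c: "\<And>n \<omega> x. \<omega> \<in> space M \<Longrightarrow> \<mu> (Suc n) \<omega> x \<le> c * \<mu> n \<omega> x"
    using SI_3[OF SI] by blast
  obtain f B where f: "\<And>\<omega>. \<omega> \<in> space M \<Longrightarrow> \<mu> 0 \<omega> = f" "\<And>x. f x \<le> B" "bounded {x. f x \<noteq> 0}"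
    using SI_1[OF SI] by blast
  define K where "K = max c 1"
  have K: "\<mu> (Suc n) \<omega> x \<le> K * \<mu> n \<omega> x" if "\<omega> \<in> space M" for n \<omega> x
    using c[OF that, of n x] mult_right_mono[OF _ nn[OF that, of n x], of c K] by (auto simp: K_def)
  have K0: "0 \<le> K" by (simp add: K_def)
  have bd: "\<mu> n \<omega> x \<le> K ^ n * B" if w: "\<omega> \<in> space M" for n \<omega> x
  proof (induction n)
    case 0
    show ?case using f(1)[OF w] f(2) by simp
  next
    case (Suc n)
    have "\<mu> (Suc n) \<omega> x \<le> K * (K ^ n * B)"
      using K[OF w, of n x] mult_left_mono[OF Suc K0] by linarith
    then show ?case by (simp add: mult.assoc)
  qed
  have zero: "\<mu> n \<omega> x = 0" if w: "\<omega> \<in> space M" and x: "x \<notin> {x. f x \<noteq> 0}" for n \<omega> x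
  proof (induction n)
    case 0
    show ?case using f(1)[OF w] x by simp
  next
    case (Suc n)
    then show ?case using K[OF w, of n x] nn[OF w, of "Suc n" x] by simp
  qed
  show ?thesis
    by (rule that[OF _ f(3) K bd zero]) (auto simp: K_def)
qed

text \<open>If the whole increment reaches P k (1 + Y), then one of the P residue classes of cubes
  reaches k (1 + Y). The order of quantifiers matters for the union bound: \<open>K\<close> and
  \<open>P\<close> depend neither on n nor on the measure nor on the free parameter
  \<open>l\<close>.\<close>

lemma SI_tail:
  fixes \<mu> :: "nat \<Rightarrow> 'w \<Rightarrow> real^'d \<Rightarrow> real"
  assumes SI: "SI_martingale M F \<mu>"
  shows "\<exists>K P. 1 \<le> K \<and> 0 < P \<and> (\<forall>n N l a k. sets N = sets borel \<longrightarrow> finite_measure N \<longrightarrow> 0 \<le> a \<longrightarrow> l * a \<le> 1 \<longrightarrow> 0 \<le> l \<longrightarrow>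
       (AE \<omega> in M. \<forall>j. K * (\<integral>x. indicator (dyadic_cube (Suc n) j) x * \<mu> n \<omega> x \<partial>N) \<le> a) \<longrightarrow>
       measure M {\<omega>\<in>space M. P * k * (1 + (\<integral>x. \<mu> n \<omega> x \<partial>N)) \<le> \<bar>(\<integral>x. \<mu> (Suc n) \<omega> x \<partial>N) - (\<integral>x. \<mu> n \<omega> x \<partial>N)\<bar>}
         \<le> 2 * P * exp (l\<^sup>2 * a * K - l * k))"
proof -
  obtain K Bd U where K: "1 \<le> K" and U: "bounded U" and
    le: "\<And>n \<omega> x. \<omega> \<in> space M \<Longrightarrow> \<mu> (Suc n) \<omega> x \<le> K * \<mu> n \<omega> x" and
    bd: "\<And>n \<omega> x. \<omega> \<in> space M \<Longrightarrow> \<mu> n \<omega> x \<le> Bd n" and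
    zero: "\<And>n \<omega> x. \<omega> \<in> space M \<Longrightarrow> x \<notin> U \<Longrightarrow> \<mu> n \<omega> x = 0"
    using SI_bounds[OF SI] by metis
  obtain c where c: "\<And>n \<Q>. \<Q> \<subseteq> range (dyadic_cube (Suc n)) \<Longrightarrow> separated_family (c / 2 ^ n) \<Q> \<Longrightarrow>
        cond_indep_sets M (F n) (restr_events M (\<mu> (Suc n))) \<Q>"
    using SI_4[OF SI] by blast
  have nn: "\<And>n \<omega> x. \<omega> \<in> space M \<Longrightarrow> 0 \<le> \<mu> n \<omega> x" using SI_nonneg[OF SI] by blast
  have mart: "\<And>n x. AE \<omega> in M. real_cond_exp M (F n) (\<lambda>\<omega>. \<mu> (Suc n) \<omega> x) \<omega> = \<mu> n \<omega> x"
    and subF: "\<And>n. subalgebra M (F n)"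
    using SI_2[OF SI] SI_subalgebra[OF SI] by blast+
  interpret prob_space M by (rule SI_prob_space[OF SI])
  \<comment> \<open>Cubes of side 2^(-(n+1)) with indices congruent modulo p are at least (p - 1)
    2^(-(n+1)) apart, so p - 1 >= 2c yields the separation asked for in (SI4). The absolute value
    keeps p positive.\<close>
  define p :: int where "p = \<lceil>2 * \<bar>c\<bar>\<rceil> + 1"
  have p: "0 < p" by (simp add: p_def add_nonneg_pos)
  have pc: "2 * c \<le> real_of_int (p - 1)" unfolding p_def by (simp) linarith
  define V where "V = {v :: 'd \<Rightarrow> int. \<forall>i. v i \<in> {0..p - 1}}"
  have finV: "finite V" unfolding V_def by (rule finite_bounded_index)
  have "(\<lambda>_. 0) \<in> V" using p by (simp add: V_def)
  then have cV: "0 < card V" using finV by (auto simp: card_gt_0_iff)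
  show ?thesis
  proof (rule exI[of _ K], rule exI[of _ "real (card V)"], intro conjI allI impI)
    show "1 \<le> K" "0 < real (card V)" using K cV by auto
  next
    fix n N and l a k :: real
    assume N: "sets N = sets borel" "finite_measure N" and a: "0 \<le> a" "l * a \<le> 1" and l: "0 \<le> l"
      and mass: "AE \<omega> in M. \<forall>j. K * (\<integral>x. indicator (dyadic_cube (Suc n) j) x * \<mu> n \<omega> x \<partial>N) \<le> a"
    interpret N: finite_measure N by (rule N)
    have spN: "space N = UNIV" using sets_eq_imp_space_eq[OF N(1)] by simp
    obtain R where R: "\<And>x i. x \<in> U \<Longrightarrow> \<lfloor>x $ i * 2 ^ (Suc n)\<rfloor> \<in> {- R..R}"
      using bounded_dyadic_index[OF U] by blast
    \<comment> \<open>Bounded support makes finitely many cubes suffice at each scale. Their number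
      may grow with n but stays out of the estimate, where only the number of residue classes
      counts.\<close>
    define Box where "Box = {k :: 'd \<Rightarrow> int. \<forall>i. k i \<in> {- R..R}}"
    have finBox: "finite Box" unfolding Box_def by (rule finite_bounded_index)
    define \<rho> where "\<rho> k = (\<lambda>i. k i mod p)" for k :: "'d \<Rightarrow> int"
    have \<rho>: "\<rho> ` Box \<subseteq> V" using p by (auto simp: \<rho>_def V_def)
    define I where "I v = {k \<in> Box. \<rho> k = v}" for v
    define \<Q> where "\<Q> v = dyadic_cube (Suc n) ` I v" for v
    have step: "one_step M (F n) (\<mu> (Suc n)) (\<mu> n) N K (Bd n) (\<Q> v)" for v
    proof (intro one_step.intro one_step_axioms.intro)
      show "prob_space M" "subalgebra M (F n)" "finite_measure N" "space N = UNIV"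
        by (fact prob_space_axioms subF N spN)+
      show "(\<lambda>(\<omega>, x). \<mu> (Suc n) \<omega> x) \<in> borel_measurable (M \<Otimes>\<^sub>M N)"
        "(\<lambda>(\<omega>, x). \<mu> n \<omega> x) \<in> borel_measurable (F n \<Otimes>\<^sub>M N)"
        using SI_joint_measurable[OF SI N(1)] by auto
      show "AE \<omega> in M. real_cond_exp M (F n) (\<lambda>\<omega>. \<mu> (Suc n) \<omega> x) \<omega> = \<mu> n \<omega> x" for x by (rule mart)
      show "disjoint (\<Q> v)" unfolding \<Q>_def by (rule disjoint_dyadic_cubes)
      show "finite (\<Q> v)" unfolding \<Q>_def I_def using finBox by auto
      show "Q \<in> sets N" if "Q \<in> \<Q> v" for Q using that by (auto simp: \<Q>_def N(1))
      show "cond_indep_sets M (F n) (restr_events M (\<mu> (Suc n))) (\<Q> v)"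
      proof (rule c)
        show "\<Q> v \<subseteq> range (dyadic_cube (Suc n))" by (auto simp: \<Q>_def)
        show "separated_family (c / 2 ^ n) (\<Q> v)"
          unfolding separated_family_def
        proof (intro ballI impI)
          fix Q Q' x y assume *: "Q \<in> \<Q> v" "Q' \<in> \<Q> v" "Q \<noteq> Q'" "x \<in> Q" "y \<in> Q'"
          then obtain k k' where k: "Q = dyadic_cube (Suc n) k" "Q' = dyadic_cube (Suc n) k'"
            "\<rho> k = v" "\<rho> k' = v" by (auto simp: \<Q>_def I_def)
          have "k i mod p = k' i mod p" for i using k(3,4) by (auto simp: \<rho>_def fun_eq_iff)
          then have "real_of_int (p - 1) / 2 ^ Suc n \<le> dist x y"
            using * k p by (intro dyadic_cube_separated[of k k']) auto
          moreover have "c / 2 ^ n \<le> real_of_int (p - 1) / 2 ^ Suc n"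
            using pc by (simp add: field_simps)
          ultimately show "c / 2 ^ n \<le> dist x y" by linarith
        qed
      qed
    qed (use nn le bd K in auto)
    define S where "S v \<omega> = (\<Sum>Q\<in>\<Q> v. \<integral>x. indicator Q x * (\<mu> (Suc n) \<omega> x - \<mu> n \<omega> x) \<partial>N)" for v \<omega>
    define D where "D \<omega> = (\<integral>x. \<mu> (Suc n) \<omega> x \<partial>N) - (\<integral>x. \<mu> n \<omega> x \<partial>N)" for \<omega>
    define Y where "Y \<omega> = (\<integral>x. \<mu> n \<omega> x \<partial>N)" for \<omega>
    have tail: "prob {\<omega>\<in>space M. k * (1 + Y \<omega>) \<le> \<bar>S v \<omega>\<bar>} \<le> 2 * exp (l\<^sup>2 * a * K - l * k)" for v
    proof -
      have "AE \<omega> in M. \<forall>Q\<in>\<Q> v. one_step.mass (\<mu> n) N K Q \<omega> \<le> a"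
        using mass by eventually_elim (auto simp: one_step.mass_def[OF step] \<Q>_def)
      from one_step.tail_bound[OF step a l this, of k]
      show ?thesis by (simp add: one_step.incr_def[OF step] S_def Y_def)
    qed
    have S_meas[measurable]: "S v \<in> borel_measurable M" for v
      unfolding S_def one_step.incr_def[OF step, symmetric]
      by (intro borel_measurable_sum one_step.incr_meas[OF step])
    have Y_meas[measurable]: "Y \<in> borel_measurable M"
      unfolding Y_def by (rule measurable_from_subalg[OF subF one_step.total_meas_G[OF step]])
    have D_sum: "D \<omega> = (\<Sum>v\<in>V. S v \<omega>)" if w: "\<omega> \<in> space M" for \<omega>
    proof -
      note int = one_step.integrable_f_sec[OF step w] one_step.integrable_g_sec[OF step w]
      define h where "h x = \<mu> (Suc n) \<omega> x - \<mu> n \<omega> x" for x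
      have int_h: "integrable N h" unfolding h_def using int by auto
      have int_i: "integrable N (\<lambda>x. indicator (dyadic_cube (Suc n) j) x * h x)" for j
        using integrable_real_mult_indicator[OF _ int_h] N(1) by (simp add: mult.commute)
      have "(\<Sum>v\<in>V. S v \<omega>) = (\<Sum>v\<in>V. \<Sum>j\<in>I v. \<integral>x. indicator (dyadic_cube (Suc n) j) x * h x \<partial>N)"
        unfolding S_def \<Q>_def h_def
        by (subst sum.reindex) (auto intro: inj_on_subset[OF inj_dyadic_cube])
      also have "\<dots> = (\<Sum>j\<in>Box. \<integral>x. indicator (dyadic_cube (Suc n) j) x * h x \<partial>N)"
        unfolding I_def by (rule sum.group[OF finBox finV \<rho>])
      also have "\<dots> = (\<integral>x. (\<Sum>j\<in>Box. indicator (dyadic_cube (Suc n) j) x * h x) \<partial>N)"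
        by (rule Bochner_Integration.integral_sum[symmetric]) (rule int_i)
      also have "\<dots> = (\<integral>x. h x \<partial>N)"
      proof (intro Bochner_Integration.integral_cong refl)
        fix x
        show "(\<Sum>j\<in>Box. indicator (dyadic_cube (Suc n) j) x * h x) = h x"
        proof (cases "x \<in> U")
          case True
          then have "(\<lambda>i. \<lfloor>x $ i * 2 ^ Suc n\<rfloor>) \<in> Box" using R unfolding Box_def by auto
          from sum_indicator_dyadic_cube[OF finBox this] show ?thesis
            by (simp add: sum_distrib_right[symmetric])
        next
          case False
          then show ?thesis using zero[OF w] by (simp add: h_def)
        qed
      qed
      also have "\<dots> = D \<omega>" using int by (simp add: h_def D_def)
      finally show ?thesis by simp
    qed
    have "prob {\<omega>\<in>space M. real (card V) * k * (1 + Y \<omega>) \<le> \<bar>D \<omega>\<bar>}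
        \<le> prob (\<Union>v\<in>V. {\<omega>\<in>space M. k * (1 + Y \<omega>) \<le> \<bar>S v \<omega>\<bar>})"
    proof (rule finite_measure_mono)
      show "{\<omega>\<in>space M. real (card V) * k * (1 + Y \<omega>) \<le> \<bar>D \<omega>\<bar>}
          \<subseteq> (\<Union>v\<in>V. {\<omega>\<in>space M. k * (1 + Y \<omega>) \<le> \<bar>S v \<omega>\<bar>})"
      proof (rule subsetI, rule ccontr)
        fix \<omega> assume w: "\<omega> \<in> {\<omega>\<in>space M. real (card V) * k * (1 + Y \<omega>) \<le> \<bar>D \<omega>\<bar>}"
          and "\<omega> \<notin> (\<Union>v\<in>V. {\<omega>\<in>space M. k * (1 + Y \<omega>) \<le> \<bar>S v \<omega>\<bar>})"
        then have lt: "\<And>v. v \<in> V \<Longrightarrow> \<bar>S v \<omega>\<bar> < k * (1 + Y \<omega>)" by force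
        have "\<bar>D \<omega>\<bar> \<le> (\<Sum>v\<in>V. \<bar>S v \<omega>\<bar>)" using w by (auto simp: D_sum intro: sum_abs)
        also have "\<dots> < (\<Sum>v\<in>V. k * (1 + Y \<omega>))"
          using lt finV cV by (intro sum_strict_mono) auto
        finally show False using w by simp
      qed
      show "(\<Union>v\<in>V. {\<omega>\<in>space M. k * (1 + Y \<omega>) \<le> \<bar>S v \<omega>\<bar>}) \<in> events"
        using finV by (intro sets.finite_UN) auto
    qed
    also have "\<dots> \<le> (\<Sum>v\<in>V. prob {\<omega>\<in>space M. k * (1 + Y \<omega>) \<le> \<bar>S v \<omega>\<bar>})"
      using finV by (intro finite_measure_subadditive_finite) auto
    also have "\<dots> \<le> (\<Sum>v\<in>V. 2 * exp (l\<^sup>2 * a * K - l * k))"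
      by (intro sum_mono tail)
    finally show "prob {\<omega>\<in>space M. real (card V) * k * (1 + (\<integral>x. \<mu> n \<omega> x \<partial>N)) \<le> \<bar>(\<integral>x. \<mu> (Suc n) \<omega> x \<partial>N) - (\<integral>x. \<mu> n \<omega> x \<partial>N)\<bar>}
         \<le> 2 * real (card V) * exp (l\<^sup>2 * a * K - l * k)"
      by (simp add: D_def Y_def)
  qed
qed

section \<open>Geometric increments\<close>

lemma powr_minus_eq_power: "2 powr (- c * real n) = (2 powr - c) ^ n"
  by (simp add: powr_power mult.commute)

lemma powr_minus_less_one: "0 < c \<Longrightarrow> 2 powr - c < (1::real)"
  by (simp add: powr_less_one)

lemma summable_powr_minus: "0 < c \<Longrightarrow> summable (\<lambda>n. 2 powr (- c * real n))"
  unfolding powr_minus_eq_power using powr_minus_less_one by (intro summable_geometric) auto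

text \<open>The two exponents are the entropy of the net and the gain from the tail estimate; the
  doubled rate lets the gain win for any \<open>D\<close>, with enough room for a geometric
  majorant.\<close>

lemma summable_exp_minus_powr:
  fixes D \<epsilon> P :: real
  assumes "0 < \<epsilon>" "0 < P"
  shows "summable (\<lambda>n. exp (D * 2 powr (\<epsilon> * real n) - 2 powr (2 * \<epsilon> * real n) / P))"
proof (rule summable_comparison_test_ev)
  define E where "E = \<bar>D\<bar> + 1"
  have E: "0 < E" "D \<le> E" by (auto simp: E_def)
  have "eventually (\<lambda>n. E * 2 powr (\<epsilon> * real n) - 2 powr (2 * \<epsilon> * real n) / P \<le> - real n) sequentially"
    using assms E by real_asymp
  then show "eventually (\<lambda>n. norm (exp (D * 2 powr (\<epsilon> * real n) - 2 powr (2 * \<epsilon> * real n) / P)) \<le> exp (- 1) ^ n) sequentially"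
  proof eventually_elim
    case (elim n)
    have "D * 2 powr (\<epsilon> * real n) \<le> E * 2 powr (\<epsilon> * real n)" using E by (intro mult_right_mono) auto
    then have "D * 2 powr (\<epsilon> * real n) - 2 powr (2 * \<epsilon> * real n) / P \<le> - real n" using elim by linarith
    then show ?case by (simp add: exp_of_nat_mult[symmetric])
  qed
  show "summable (\<lambda>n. exp (- 1) ^ n :: real)" by (rule summable_geometric) simp
qed

text \<open>Discrete Gronwall argument: 1 + Y grows per step at most by 1 + E 2^(-cn) <= exp(E
  2^(-cn)), and these exponents are summable. The resulting bound turns relative increments into
  absolute ones, with one constant for all of \<open>\<Gamma>\<close>.\<close>

lemma multiplicative_increments_geometric:
  fixes Y :: "nat \<Rightarrow> 'g \<Rightarrow> real"
  assumes c: "0 < c" and E: "0 \<le> E"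
    and nonneg: "\<And>n t. t \<in> \<Gamma> \<Longrightarrow> 0 \<le> Y n t"
    and start: "\<And>t. t \<in> \<Gamma> \<Longrightarrow> Y n1 t \<le> D"
    and step: "\<And>n t. n1 \<le> n \<Longrightarrow> t \<in> \<Gamma> \<Longrightarrow> \<bar>Y (Suc n) t - Y n t\<bar> \<le> E * 2 powr (- c * real n) * (1 + Y n t)"
  shows "\<exists>L. \<forall>n\<ge>n1. \<forall>t\<in>\<Gamma>. \<bar>Y (Suc n) t - Y n t\<bar> \<le> L * 2 powr (- c * real n)"
proof -
  define k where "k n = 2 powr (- c * real n)" for n
  have k: "summable k" "\<And>n. 0 \<le> k n" unfolding k_def using summable_powr_minus[OF c] by auto
  define G where "G = (1 + D) * exp (E * suminf k)"
  have grow: "1 + Y n t \<le> (1 + D) * exp (E * sum k {..<n})" if n: "n1 \<le> n" and t: "t \<in> \<Gamma>" for n t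
    using n
  proof (induction n rule: dec_induct)
    case base
    have "(1 + D) * 1 \<le> (1 + D) * exp (E * sum k {..<n1})"
      using E k(2) start[OF t] nonneg[OF t, of n1] by (intro mult_left_mono) (auto intro!: mult_nonneg_nonneg sum_nonneg)
    then show ?case using start[OF t] by simp
  next
    case (step n)
    have "1 + Y (Suc n) t \<le> (1 + E * k n) * (1 + Y n t)"
      using assms(5)[OF step(1) t] by (simp add: k_def algebra_simps abs_le_iff)
    also have "\<dots> \<le> exp (E * k n) * ((1 + D) * exp (E * sum k {..<n}))"
      using step(3) nonneg[OF t, of n] by (intro mult_mono exp_ge_add_one_self) auto
    also have "\<dots> = (1 + D) * exp (E * sum k {..<Suc n})"
      by (simp add: exp_add[symmetric] algebra_simps)
    finally show ?case .
  qed
  have "\<bar>Y (Suc n) t - Y n t\<bar> \<le> (E * G) * k n" if n: "n1 \<le> n" and t: "t \<in> \<Gamma>" for n t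
  proof -
    have "1 + Y n t \<le> (1 + D) * exp (E * sum k {..<n})" by (rule grow[OF n t])
    also have "\<dots> \<le> G"
      unfolding G_def using start[OF t] nonneg[OF t, of n1] E sum_le_suminf[OF k(1), of "{..<n}"] k(2)
      by (intro mult_left_mono) (auto intro!: mult_left_mono)
    finally have "E * k n * (1 + Y n t) \<le> E * k n * G"
      using E k(2)[of n] by (intro mult_left_mono) auto
    then show ?thesis using step[OF n t] by (simp add: k_def mult_ac)
  qed
  then show ?thesis unfolding k_def by blast
qed

lemma geometric_increments_limit:
  fixes Y :: "nat \<Rightarrow> real"
  assumes c: "0 < c"
    and inc: "\<And>n. n1 \<le> n \<Longrightarrow> \<bar>Y (Suc n) - Y n\<bar> \<le> L * 2 powr (- c * real n)"
    and n: "n1 \<le> n"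
  shows "\<bar>Y n - lim Y\<bar> \<le> L / (1 - 2 powr - c) * 2 powr (- c * real n)"
proof -
  define x where "x = 2 powr - c"
  have x: "0 < x" "x < 1" using powr_minus_less_one[OF c] by (auto simp: x_def)
  have inc': "\<bar>Y (Suc n) - Y n\<bar> \<le> L * x ^ n" if "n1 \<le> n" for n
    using inc[OF that] unfolding powr_minus_eq_power x_def .
  have "0 \<le> L * x ^ n1" using inc'[of n1] by linarith
  then have L: "0 \<le> L" using zero_less_power[OF x(1), of n1] by (auto simp: zero_le_mult_iff)
  have "summable (\<lambda>n. Y (Suc n) - Y n)"
  proof (rule summable_comparison_test)
    show "\<exists>N. \<forall>n\<ge>N. norm (Y (Suc n) - Y n) \<le> L * x ^ n" using inc' by auto
    show "summable (\<lambda>n. L * x ^ n)" using x by (intro summable_mult summable_geometric) auto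
  qed
  then have "convergent (\<lambda>n. \<Sum>j<n. Y (Suc j) - Y j)" by (simp add: summable_iff_convergent)
  then have "convergent (\<lambda>n. Y n - Y 0)" by (simp add: sum_lessThan_telescope)
  then have "convergent Y" by (simp add: convergent_diff_const_right_iff)
  then have lim: "Y \<longlonglongrightarrow> lim Y" by (simp add: convergent_LIMSEQ_iff)
  \<comment> \<open>Keeping the difference of the powers makes the geometric sum close exactly in
    the induction; the subtracted term is dropped afterwards.\<close>
  have tele: "\<bar>Y n - Y m\<bar> \<le> L / (1 - x) * (x ^ n - x ^ m)" if "n \<le> m" for m
    using that
  proof (induction m rule: dec_induct)
    case (step m)
    have "\<bar>Y n - Y (Suc m)\<bar> \<le> L / (1 - x) * (x ^ n - x ^ m) + L * x ^ m"
      using step inc'[of m] n by linarith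
    also have "\<dots> = L / (1 - x) * (x ^ n - x ^ Suc m)" using x by (simp add: field_simps)
    finally show ?case .
  qed simp
  have "\<bar>Y n - lim Y\<bar> \<le> L / (1 - x) * x ^ n"
  proof (rule LIMSEQ_le_const2)
    show "(\<lambda>m. \<bar>Y n - Y m\<bar>) \<longlonglongrightarrow> \<bar>Y n - lim Y\<bar>" by (intro tendsto_intros lim)
    show "\<exists>N. \<forall>m\<ge>N. \<bar>Y n - Y m\<bar> \<le> L / (1 - x) * x ^ n"
    proof (intro exI allI impI)
      fix m assume "n \<le> m"
      have "L / (1 - x) * (x ^ n - x ^ m) \<le> L / (1 - x) * x ^ n"
        using x L by (intro mult_left_mono) auto
      then show "\<bar>Y n - Y m\<bar> \<le> L / (1 - x) * x ^ n" using tele[OF \<open>n \<le> m\<close>] by linarith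
    qed
  qed
  then show ?thesis unfolding powr_minus_eq_power x_def .
qed

text \<open>The two terms balance, up to constants, where 2^(-(\<theta>+c)n) equals
  \<open>d powr \<gamma>0\<close>; there both are of order \<open>d\<close> to the power c
  \<gamma>0/(\<theta>+c). For large \<open>d\<close> this scale lies below \<open>n2\<close>, and
  the a priori bound \<open>S\<close> takes over.\<close>

lemma holder_interpolation:
  fixes c \<theta> \<gamma>0 \<gamma> L C S :: real
  assumes c: "0 < c" and \<theta>: "0 < \<theta>" and \<gamma>0: "0 < \<gamma>0" and \<gamma>: "0 < \<gamma>" "\<gamma> \<le> c * \<gamma>0 / (\<theta> + c)"
    and L: "0 \<le> L" and C: "0 \<le> C" and S: "0 \<le> S"
  shows "\<exists>H. \<forall>d x. 0 < d \<longrightarrow> x \<le> S \<longrightarrow>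
    (\<forall>n\<ge>n2. x \<le> L * 2 powr (- c * real n) + C * 2 powr (\<theta> * real n) * d powr \<gamma>0) \<longrightarrow> x \<le> H * d powr \<gamma>"
proof -
  define b where "b = \<gamma>0 / (\<theta> + c)"
  have b: "0 < b" using assms by (simp add: b_def)
  \<comment> \<open>The distance whose balancing scale \<open>z\<close> is exactly
    \<open>n2\<close>.\<close>
  define d0 where "d0 = 2 powr (- (real n2 / b))"
  have d0: "0 < d0" by (simp add: d0_def)
  define H where "H = L * 2 powr c + C + S / d0 powr \<gamma>"
  have H1: "L * 2 powr c + C \<le> H" "S / d0 powr \<gamma> \<le> H" using L C S by (auto simp: H_def)
  show ?thesis
  proof (intro exI[of _ H] allI impI)
    fix d x :: real
    assume d: "0 < d" and xS: "x \<le> S"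
      and x: "\<forall>n\<ge>n2. x \<le> L * 2 powr (- c * real n) + C * 2 powr (\<theta> * real n) * d powr \<gamma>0"
    define z where "z = - b * log 2 d"
    have d_eq: "d = 2 powr (- z / b)" using d b by (simp add: z_def)
    show "x \<le> H * d powr \<gamma>"
    proof (cases "real n2 \<le> z")
      case True
      \<comment> \<open>Rounding down keeps the \<open>\<theta>\<close> term below its balanced
        value and costs a factor of at most \<open>2 powr c\<close> in the other term.\<close>
      define n where "n = nat \<lfloor>z\<rfloor>"
      have z0: "0 \<le> z" using True by linarith
      have n: "n2 \<le> n" "real n \<le> z" "z < real n + 1"
        using True z0 unfolding n_def by linarith+
      have "2 powr (- c * real n) \<le> 2 powr c * 2 powr (- c * z)"
      proof -
        have "c * z \<le> c * (real n + 1)" using n c by (intro mult_left_mono) auto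
        then show ?thesis by (simp add: powr_add[symmetric] algebra_simps)
      qed
      moreover have "2 powr (\<theta> * real n) * d powr \<gamma>0 \<le> 2 powr (- c * z)"
      proof -
        have "\<theta> * real n - z / b * \<gamma>0 \<le> \<theta> * z - z / b * \<gamma>0" using n \<theta> by simp
        also have "\<dots> = - c * z" using \<gamma>0 c \<theta> by (simp add: b_def field_simps)
        finally show ?thesis by (simp add: d_eq powr_powr powr_add[symmetric])
      qed
      ultimately have "x \<le> L * (2 powr c * 2 powr (- c * z)) + C * 2 powr (- c * z)"
        using x n(1) L C by (smt (verit) mult_left_mono mult.assoc)
      also have "\<dots> = (L * 2 powr c + C) * 2 powr (- c * z)" by (simp add: algebra_simps)
      also have "\<dots> \<le> (L * 2 powr c + C) * d powr \<gamma>"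
      proof (rule mult_left_mono)
        have "\<gamma> / b \<le> c" using \<gamma>(2) \<gamma>0 c \<theta> by (simp add: b_def field_simps)
        then have "z * (\<gamma> / b) \<le> z * c" using z0 by (intro mult_left_mono) auto
        then show "2 powr (- c * z) \<le> d powr \<gamma>" by (simp add: d_eq powr_powr mult_ac)
      qed (use L C in auto)
      also have "\<dots> \<le> H * d powr \<gamma>" using H1 by (intro mult_right_mono) auto
      finally show ?thesis .
    next
      case False
      have "d0 \<le> d" unfolding d0_def d_eq using False b by (simp add: divide_right_mono)
      then have "d0 powr \<gamma> \<le> d powr \<gamma>" using d0 \<gamma> by (intro powr_mono2) auto
      then have "S \<le> S / d0 powr \<gamma> * d powr \<gamma>"
        using S d0 by (simp add: field_simps mult_left_mono)
      also have "\<dots> \<le> H * d powr \<gamma>" using H1 by (intro mult_right_mono) auto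
      finally show ?thesis using xS by linarith
    qed
  qed
qed

text \<open>Here \<open>s\<close> is the gap \<open>s - \<alpha>\<close> of the theorem. The rates
  increase to half of it, so countably many rates reach every admissible exponent, and one null set
  serves all \<open>\<gamma>\<close>. The shift by 2 keeps the rate for \<open>m = 0\<close>
  positive.\<close>

lemma holder_exponent_exhausted:
  fixes s \<theta> \<gamma>0 \<gamma> :: real
  assumes "0 < s" "0 < \<theta>" "\<gamma> < s * \<gamma>0 / (s + 2 * \<theta>)"
  shows "\<exists>m::nat. \<gamma> \<le> (s / 2 * (1 - 1 / (real m + 2))) * \<gamma>0 / (\<theta> + s / 2 * (1 - 1 / (real m + 2)))"
proof -
  have lim: "(\<lambda>m::nat. s / 2 * (1 - 1 / (real m + 2))) \<longlonglongrightarrow> s / 2" by real_asymp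
  have conv: "(\<lambda>m::nat. (s / 2 * (1 - 1 / (real m + 2))) * \<gamma>0 / (\<theta> + s / 2 * (1 - 1 / (real m + 2))))
      \<longlonglongrightarrow> s / 2 * \<gamma>0 / (\<theta> + s / 2)"
    using assms by (intro tendsto_intros lim) auto
  have "s / 2 * \<gamma>0 / (\<theta> + s / 2) = s * \<gamma>0 / (s + 2 * \<theta>)"
    using assms by (simp add: divide_simps)
  with assms(3) have "\<gamma> < s / 2 * \<gamma>0 / (\<theta> + s / 2)" by linarith
  from order_tendstoD(1)[OF conv this]
  obtain m where "\<gamma> < (s / 2 * (1 - 1 / (real m + 2))) * \<gamma>0 / (\<theta> + s / 2 * (1 - 1 / (real m + 2)))"
    by (auto simp: eventually_sequentially)
  then show ?thesis by (intro exI[of _ m]) simp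
qed

section \<open>Uniform convergence over the index set\<close>

text \<open>Finitely many balls of radius 1/2, within the range of (H2), cover the support; this
  bounds the relevant mass of \<open>\<eta> t\<close> uniformly in \<open>t\<close>.\<close>

lemma integral_bounded_support:
  fixes \<eta> :: "'g \<Rightarrow> ('a::euclidean_space) measure" and U :: "'a set"
  assumes U: "bounded U" and C: "0 \<le> C"
    and eta_borel: "\<forall>t\<in>\<Gamma>. sets (\<eta> t) = sets borel"
    and eta_finite: "\<forall>t\<in>\<Gamma>. finite_measure (\<eta> t)"
    and H2: "\<forall>x t r. t \<in> \<Gamma> \<longrightarrow> 0 < r \<longrightarrow> r < 1 \<longrightarrow> measure (\<eta> t) (cball x r) \<le> C * r powr s"
  shows "\<exists>D::real. 0 \<le> D \<and> (\<forall>t\<in>\<Gamma>. \<forall>h b. 0 \<le> b \<longrightarrow> (\<forall>x. h x \<le> b) \<longrightarrow> (\<forall>x. x \<notin> U \<longrightarrow> h x = 0) \<longrightarrow> (\<integral>x. h x \<partial>\<eta> t) \<le> b * D)"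
proof -
  have "\<exists>T. finite T \<and> closure U \<subseteq> (\<Union>x\<in>T. ball x (1/2))"
    using U compact_closure[of U] compact_eq_totally_bounded[of "closure U"]
    by (metis half_gt_zero zero_less_one)
  then obtain T where T: "finite T" "closure U \<subseteq> (\<Union>x\<in>T. ball x (1/2))" by auto
  define D where "D = real (card T) * (C * (1/2) powr s)"
  show ?thesis
  proof (intro exI[of _ D] conjI ballI allI impI)
    show "0 \<le> D" using C by (simp add: D_def)
  next
    fix t h and b :: real
    assume t: "t \<in> \<Gamma>" and b: "0 \<le> b" and h: "\<forall>x. h x \<le> b" "\<forall>x. x \<notin> U \<longrightarrow> h x = 0"
    interpret N: finite_measure "\<eta> t" using eta_finite t by auto
    have [simp]: "sets (\<eta> t) = sets borel" using eta_borel t by auto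
    have int: "integrable (\<eta> t) (\<lambda>y. indicat_real (cball x (1/2)) y)" for x
      by (simp add: integrable_indicator_iff less_top[symmetric])
    have "(\<integral>x. h x \<partial>\<eta> t) \<le> (\<integral>y. (\<Sum>x\<in>T. b * indicator (cball x (1/2)) y) \<partial>\<eta> t)"
    \<comment> \<open>Integrability is asked of the majorant alone: a non-integrable
      \<open>h\<close> has integral 0, which the nonnegative majorant covers.\<close>
    proof (rule integral_mono')
      show "integrable (\<eta> t) (\<lambda>y. \<Sum>x\<in>T. b * indicator (cball x (1/2)) y)"
        using int by auto
      show "0 \<le> (\<Sum>x\<in>T. b * indicator (cball x (1/2)) y)" for y
        using b by (intro sum_nonneg) auto
      show "h y \<le> (\<Sum>x\<in>T. b * indicator (cball x (1/2)) y)" for y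
      proof (cases "y \<in> U")
        case True
        then have "y \<in> (\<Union>x\<in>T. ball x (1/2))" using T(2) closure_subset by blast
        then obtain x where x: "x \<in> T" "y \<in> cball x (1/2)" by auto
        have "h y \<le> b * indicator (cball x (1/2)) y" using h(1) x by simp
        also have "\<dots> \<le> (\<Sum>x\<in>T. b * indicator (cball x (1/2)) y)"
          using x T(1) b by (intro member_le_sum) auto
        finally show ?thesis .
      qed (use h b in \<open>auto intro!: sum_nonneg\<close>)
    qed
    also have "\<dots> = (\<Sum>x\<in>T. b * measure (\<eta> t) (cball x (1/2)))"
      using int by (subst Bochner_Integration.integral_sum) auto
    also have "\<dots> \<le> (\<Sum>x\<in>T. b * (C * (1/2) powr s))"
      using H2[rule_format, OF t, of "1/2"] b by (intro sum_mono mult_left_mono) auto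
    also have "\<dots> = b * D" by (simp add: D_def)
    finally show "(\<integral>x. h x \<partial>\<eta> t) \<le> b * D" .
  qed
qed

text \<open>The cube lies in a ball of radius \<open>CARD('d) / 2 ^ n\<close>, and the condition on
  \<open>n\<close> puts this radius into the range where the Frostman bound holds.\<close>

lemma dyadic_cube_integral_le:
  fixes N :: "(real^'d) measure"
  assumes N: "sets N = sets borel" "finite_measure N"
    and frostman: "\<And>x r. 0 < r \<Longrightarrow> r < 1 \<Longrightarrow> measure N (cball x r) \<le> C * r powr s"
    and n: "real CARD('d) < 2 ^ n" and b: "0 \<le> b" and h: "\<And>x. h x \<le> b"
  shows "(\<integral>x. indicator (dyadic_cube (Suc n) j) x * h x \<partial>N) \<le> b * (C * (real CARD('d) powr s * 2 powr (- s * real n)))"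
proof -
  interpret finite_measure N by (rule N)
  obtain z where z: "z \<in> dyadic_cube (Suc n) j" using dyadic_cube_nonempty by blast
  define r where "r = real CARD('d) / 2 ^ n"
  have r: "0 < r" "r < 1" using n by (auto simp: r_def)
  have sub: "dyadic_cube (Suc n) j \<subseteq> cball z r"
  proof -
    have "real CARD('d) / 2 ^ Suc n \<le> r" by (simp add: r_def field_simps)
    then show ?thesis using dyadic_cube_subset_cball[OF z] by (auto intro: order_trans)
  qed
  have "(\<integral>x. indicator (dyadic_cube (Suc n) j) x * h x \<partial>N) \<le> (\<integral>x. b * indicator (cball z r) x \<partial>N)"
  proof (rule integral_mono')
    show "integrable N (\<lambda>x. b * indicator (cball z r) x)"
      using N by (simp add: integrable_indicator_iff less_top[symmetric])
    show "indicator (dyadic_cube (Suc n) j) x * h x \<le> b * indicator (cball z r) x" for x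
      using sub h b by (auto simp: indicator_def)
  qed (use b in auto)
  also have "\<dots> = b * measure N (cball z r)" using N by simp
  also have "\<dots> \<le> b * (C * r powr s)" using frostman[OF r] b by (intro mult_left_mono) auto
  also have "r powr s = real CARD('d) powr s * 2 powr (- s * real n)"
    by (simp add: r_def powr_divide powr_minus_divide powr_realpow[symmetric] powr_powr mult.commute)
  finally show ?thesis .
qed

text \<open>The fineness \<open>A\<close> is free because (H1) allows every positive
  \<open>\<xi>\<close>: with \<open>\<xi> = \<epsilon> / A\<close> the entropy of the net stays of
  order 2^(\<epsilon>n), however large \<open>A\<close> is.\<close>

lemma increments_on_net:
  fixes M :: "'w measure" and F :: "nat \<Rightarrow> 'w measure"
    and \<mu> :: "nat \<Rightarrow> 'w \<Rightarrow> real^'d \<Rightarrow> real"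
    and \<Gamma> :: "'g::metric_space set" and \<eta> :: "'g \<Rightarrow> (real^'d) measure"
    and \<alpha> s C :: real
  assumes SI: "SI_martingale M F \<mu>"
    and eta_borel: "\<forall>t\<in>\<Gamma>. sets (\<eta> t) = sets borel"
    and eta_finite: "\<forall>t\<in>\<Gamma>. finite_measure (\<eta> t)"
    and C: "0 < C"
    and H1: "\<forall>\<xi>>0. \<exists>C\<xi>. \<forall>r>0. \<exists>T. finite T \<and> T \<subseteq> \<Gamma> \<and>
               real (card T) \<le> exp (C\<xi> * r powr (-\<xi>)) \<and> \<Gamma> \<subseteq> (\<Union>t\<in>T. cball t r)"
    and H2: "\<forall>x t r. t \<in> \<Gamma> \<longrightarrow> 0 < r \<longrightarrow> r < 1 \<longrightarrow> measure (\<eta> t) (cball x r) \<le> C * r powr s"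
    and H3: "AE \<omega> in M. \<forall>n x. \<mu> n \<omega> x \<le> C * 2 powr (\<alpha> * real n)"
    and A: "0 < A" and c: "0 < c" "2 * c < s - \<alpha>"
  obtains T where "\<And>n. T n \<subseteq> \<Gamma>" "\<And>n. \<Gamma> \<subseteq> (\<Union>t\<in>T n. cball t (2 powr (- A * real n)))"
    "AE \<omega> in M. eventually (\<lambda>n. \<forall>t\<in>T n.
        \<bar>Yint \<mu> \<eta> (Suc n) \<omega> t - Yint \<mu> \<eta> n \<omega> t\<bar> \<le> 2 powr (- c * real n) * (1 + Yint \<mu> \<eta> n \<omega> t)) sequentially"
proof -
  interpret prob_space M by (rule SI_prob_space[OF SI])
  obtain K P where K: "1 \<le> K" and P: "0 < P" and tail:
    "\<forall>n N l a k. sets N = sets borel \<longrightarrow> finite_measure N \<longrightarrow> 0 \<le> a \<longrightarrow> l * a \<le> 1 \<longrightarrow> 0 \<le> l \<longrightarrow>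
       (AE \<omega> in M. \<forall>j. K * (\<integral>x. indicator (dyadic_cube (Suc n) j) x * \<mu> n \<omega> x \<partial>N) \<le> a) \<longrightarrow>
       measure M {\<omega>\<in>space M. P * k * (1 + (\<integral>x. \<mu> n \<omega> x \<partial>N)) \<le> \<bar>(\<integral>x. \<mu> (Suc n) \<omega> x \<partial>N) - (\<integral>x. \<mu> n \<omega> x \<partial>N)\<bar>}
         \<le> 2 * P * exp (l\<^sup>2 * a * K - l * k)"
    using SI_tail[OF SI] by (elim exE conjE) (rule that)
  \<comment> \<open>Chosen so that c + 2\<epsilon> = (s-\<alpha>)/2, which leaves the tail estimate
    the rate 2\<epsilon> against the entropy rate \<epsilon>.\<close>
  define \<epsilon> where "\<epsilon> = (s - \<alpha> - 2 * c) / 4"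
  have \<epsilon>: "0 < \<epsilon>" using c by (simp add: \<epsilon>_def)
  obtain C\<xi> where C\<xi>: "\<forall>r>0. \<exists>T. finite T \<and> T \<subseteq> \<Gamma> \<and>
     real (card T) \<le> exp (C\<xi> * r powr (- (\<epsilon> / A))) \<and> \<Gamma> \<subseteq> (\<Union>t\<in>T. cball t r)"
    using H1[THEN spec, THEN mp, OF divide_pos_pos[OF \<epsilon> A]] by (rule exE)
  have "\<exists>T. finite T \<and> T \<subseteq> \<Gamma> \<and> real (card T) \<le> exp (C\<xi> * 2 powr (\<epsilon> * real n))
      \<and> \<Gamma> \<subseteq> (\<Union>t\<in>T. cball t (2 powr (- A * real n)))" for n
  proof -
    have "(2 powr (- A * real n)) powr (- (\<epsilon> / A)) = 2 powr (\<epsilon> * real n)"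
      using A by (simp add: powr_powr field_simps)
    moreover have "0 < (2::real) powr (- A * real n)" by simp
    ultimately show ?thesis using C\<xi>[THEN spec, THEN mp, of "2 powr (- A * real n)"] by simp
  qed
  then obtain T where T: "\<And>n. finite (T n)" "\<And>n. T n \<subseteq> \<Gamma>"
    "\<And>n. real (card (T n)) \<le> exp (C\<xi> * 2 powr (\<epsilon> * real n))"
    "\<And>n. \<Gamma> \<subseteq> (\<Union>t\<in>T n. cball t (2 powr (- A * real n)))" by metis
  define q where "q = real CARD('d)"
  \<comment> \<open>One \<open>C\<close> comes from (H3), the other from (H2), and \<open>K\<close>
    from the factor in the cube masses.\<close>
  define A0 where "A0 = K * C * C * q powr s"
  have A0: "0 < A0" using K C by (simp add: A0_def q_def)
  define a where "a n = A0 * 2 powr (- (s - \<alpha>) * real n)" for n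
  \<comment> \<open>Of order \<open>a n\<close> to the power -1/2: then
    \<open>(l n)\<^sup>2 * a n\<close> is constant, \<open>l n * a n \<le> 1\<close> holds
    eventually, and \<open>l n * k n\<close> still grows like 2^(2\<epsilon>n).\<close>
  define l where "l n = 2 powr ((c + 2 * \<epsilon>) * real n)" for n
  define k where "k n = 2 powr (- c * real n) / P" for n
  define Bad where "Bad n t = {\<omega>\<in>space M. 2 powr (- c * real n) * (1 + Yint \<mu> \<eta> n \<omega> t)
      \<le> \<bar>Yint \<mu> \<eta> (Suc n) \<omega> t - Yint \<mu> \<eta> n \<omega> t\<bar>}" for n t
  have Y_meas: "(\<lambda>\<omega>. Yint \<mu> \<eta> n \<omega> t) \<in> borel_measurable M" if "t \<in> \<Gamma>" for n t
  proof -
    interpret N: finite_measure "\<eta> t" using eta_finite that by auto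
    show ?thesis
      unfolding Yint_def using SI_joint_measurable(2)[OF SI, of "\<eta> t" n] eta_borel that
      by (intro N.borel_measurable_lebesgue_integral) auto
  qed
  have Bad_meas: "Bad n t \<in> events" if "t \<in> \<Gamma>" for n t
  proof -
    note [measurable] = Y_meas[OF that]
    show ?thesis unfolding Bad_def by measurable
  qed
  have a_mass: "AE \<omega> in M. \<forall>j. K * (\<integral>x. indicator (dyadic_cube (Suc n) j) x * \<mu> n \<omega> x \<partial>\<eta> t) \<le> a n"
    if t: "t \<in> \<Gamma>" and n: "q < 2 ^ n" for n t
    using H3
  proof eventually_elim
    case (elim \<omega>)
    show ?case
    proof
      fix j
      have "K * (\<integral>x. indicator (dyadic_cube (Suc n) j) x * \<mu> n \<omega> x \<partial>\<eta> t)
          \<le> K * (C * 2 powr (\<alpha> * real n) * (C * (q powr s * 2 powr (- s * real n))))"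
        unfolding q_def using eta_borel eta_finite t H2 n K C elim
        by (intro mult_left_mono dyadic_cube_integral_le) (auto simp: q_def)
      also have "K * (C * 2 powr (\<alpha> * real n) * (C * (q powr s * 2 powr (- s * real n))))
          = A0 * (2 powr (\<alpha> * real n) * 2 powr (- s * real n))" by (simp add: A0_def mult_ac)
      also have "2 powr (\<alpha> * real n) * 2 powr (- s * real n) = 2 powr (- (s - \<alpha>) * real n)"
        by (simp add: powr_add[symmetric] algebra_simps)
      finally show "K * (\<integral>x. indicator (dyadic_cube (Suc n) j) x * \<mu> n \<omega> x \<partial>\<eta> t) \<le> a n" by (simp add: a_def)
    qed
  qed
  have l_a: "l n * a n = A0 * 2 powr (- ((s - \<alpha>) / 2) * real n)" for n
  proof -
    have "(c + 2 * \<epsilon>) * real n + - (s - \<alpha>) * real n = - ((s - \<alpha>) / 2) * real n"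
      by (simp add: \<epsilon>_def field_simps)
    then show ?thesis by (simp add: l_def a_def powr_add[symmetric] mult.left_commute)
  qed
  have l2_a: "(l n)\<^sup>2 * a n = A0" for n
  proof -
    have "(c + 2 * \<epsilon>) * real n + ((c + 2 * \<epsilon>) * real n + - (s - \<alpha>) * real n) = 0"
      by (simp add: \<epsilon>_def field_simps)
    then show ?thesis by (simp add: l_def a_def powr_add[symmetric] power2_eq_square mult.left_commute mult.assoc)
  qed
  have l_k: "l n * k n = 2 powr (2 * \<epsilon> * real n) / P" for n
    by (simp add: l_def k_def powr_add[symmetric] algebra_simps)
  have Bad_prob: "prob (Bad n t) \<le> 2 * P * exp (A0 * K - 2 powr (2 * \<epsilon> * real n) / P)"
    if t: "t \<in> \<Gamma>" and n: "q < 2 ^ n" and la: "l n * a n \<le> 1" for n t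
  proof -
    have "measure M {\<omega>\<in>space M. P * k n * (1 + (\<integral>x. \<mu> n \<omega> x \<partial>\<eta> t)) \<le> \<bar>(\<integral>x. \<mu> (Suc n) \<omega> x \<partial>\<eta> t) - (\<integral>x. \<mu> n \<omega> x \<partial>\<eta> t)\<bar>}
        \<le> 2 * P * exp ((l n)\<^sup>2 * a n * K - l n * k n)"
      using eta_borel eta_finite t A0 la a_mass[OF t n]
      by (intro tail[rule_format]) (auto simp: a_def l_def)
    then show ?thesis using P unfolding l2_a l_k by (simp add: Bad_def Yint_def k_def)
  qed
  define Bad' where "Bad' n = (\<Union>t\<in>T n. Bad n t)" for n
  have Bad'_meas: "Bad' n \<in> events" for n
    unfolding Bad'_def by (intro sets.finite_UN T(1) Bad_meas subsetD[OF T(2)])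
  have ev1: "eventually (\<lambda>n. l n * a n \<le> 1) sequentially"
  proof -
    have "0 < (s - \<alpha>) / 2" using c by simp
    then have "eventually (\<lambda>n::nat. A0 * 2 powr (- ((s - \<alpha>) / 2) * real n) \<le> 1) sequentially"
      by real_asymp
    then show ?thesis unfolding l_a .
  qed
  have ev2: "eventually (\<lambda>n. q < 2 ^ n) sequentially" by real_asymp
  have "summable (\<lambda>n. prob (Bad' n))"
  proof (rule summable_comparison_test_ev)
    show "eventually (\<lambda>n. norm (prob (Bad' n)) \<le> 2 * P * exp (A0 * K) *
        exp (C\<xi> * 2 powr (\<epsilon> * real n) - 2 powr (2 * \<epsilon> * real n) / P)) sequentially"
      using ev1 ev2
    proof eventually_elim
      case (elim n)
      have "prob (Bad' n) \<le> (\<Sum>t\<in>T n. prob (Bad n t))"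
        unfolding Bad'_def using T(1) Bad_meas subsetD[OF T(2)] by (intro finite_measure_subadditive_finite) auto
      also have "\<dots> \<le> (\<Sum>t\<in>T n. 2 * P * exp (A0 * K - 2 powr (2 * \<epsilon> * real n) / P))"
        using T(2) elim by (intro sum_mono Bad_prob) auto
      also have "\<dots> = real (card (T n)) * (2 * P * exp (A0 * K - 2 powr (2 * \<epsilon> * real n) / P))" by simp
      also have "\<dots> \<le> exp (C\<xi> * 2 powr (\<epsilon> * real n)) * (2 * P * exp (A0 * K - 2 powr (2 * \<epsilon> * real n) / P))"
        using T(3) P by (intro mult_right_mono) auto
      also have "\<dots> = 2 * P * exp (A0 * K) * exp (C\<xi> * 2 powr (\<epsilon> * real n) - 2 powr (2 * \<epsilon> * real n) / P)"
        by (simp add: exp_diff)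
      finally show ?case by simp
    qed
    show "summable (\<lambda>n. 2 * P * exp (A0 * K) *
        exp (C\<xi> * 2 powr (\<epsilon> * real n) - 2 powr (2 * \<epsilon> * real n) / P))"
      by (intro summable_mult summable_exp_minus_powr \<epsilon> P)
  qed
  then have "AE \<omega> in M. eventually (\<lambda>n. \<omega> \<in> space M - Bad' n) sequentially"
    using Bad'_meas by (intro borel_cantelli_AE1) (auto simp: less_top[symmetric])
  then have "AE \<omega> in M. eventually (\<lambda>n. \<forall>t\<in>T n.
        \<bar>Yint \<mu> \<eta> (Suc n) \<omega> t - Yint \<mu> \<eta> n \<omega> t\<bar> \<le> 2 powr (- c * real n) * (1 + Yint \<mu> \<eta> n \<omega> t)) sequentially"
  proof eventually_elim
    case (elim \<omega>)
    then show ?case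
      by eventually_elim (auto simp: Bad'_def Bad_def not_le intro: less_imp_le)
  qed
  with that[OF T(2,4)] show ?thesis .
qed

text \<open>Deterministic and uniform in \<open>t\<close>, but not in \<open>n\<close>. It supplies
  the starting value of the Gronwall argument at a random time and controls the finitely many
  indices before such a time.\<close>

lemma Yint_bounded:
  fixes \<mu> :: "nat \<Rightarrow> 'w \<Rightarrow> real^'d \<Rightarrow> real"
  assumes SI: "SI_martingale M F \<mu>" and C: "0 \<le> C"
    and eta_borel: "\<forall>t\<in>\<Gamma>. sets (\<eta> t) = sets borel"
    and eta_finite: "\<forall>t\<in>\<Gamma>. finite_measure (\<eta> t)"
    and H2: "\<forall>x t r. t \<in> \<Gamma> \<longrightarrow> 0 < r \<longrightarrow> r < 1 \<longrightarrow> measure (\<eta> t) (cball x r) \<le> C * r powr s"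
  shows "\<exists>S. \<forall>n. 0 \<le> S n \<and> (\<forall>\<omega>\<in>space M. \<forall>t\<in>\<Gamma>. 0 \<le> Yint \<mu> \<eta> n \<omega> t \<and> Yint \<mu> \<eta> n \<omega> t \<le> S n)"
proof -
  obtain K Bd U where U: "bounded U"
    and bd: "\<And>n \<omega> x. \<omega> \<in> space M \<Longrightarrow> \<mu> n \<omega> x \<le> Bd n"
    and zero: "\<And>n \<omega> x. \<omega> \<in> space M \<Longrightarrow> x \<notin> U \<Longrightarrow> \<mu> n \<omega> x = 0"
    using SI_bounds[OF SI] by metis
  obtain D :: real where D: "0 \<le> D" and int:
    "\<forall>t\<in>\<Gamma>. \<forall>h b. 0 \<le> b \<longrightarrow> (\<forall>x. h x \<le> b) \<longrightarrow> (\<forall>x. x \<notin> U \<longrightarrow> h x = 0) \<longrightarrow> (\<integral>x. h x \<partial>\<eta> t) \<le> b * D"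
    using integral_bounded_support[OF U C eta_borel eta_finite H2] by (elim exE conjE) (rule that, assumption+)
  show ?thesis
  proof (intro exI[of _ "\<lambda>n. max 0 (Bd n) * D"] allI conjI ballI)
    fix n \<omega> t assume w: "\<omega> \<in> space M" and t: "t \<in> \<Gamma>"
    show "0 \<le> Yint \<mu> \<eta> n \<omega> t"
      unfolding Yint_def using SI_nonneg[OF SI] w by (intro integral_nonneg_AE) auto
    show "Yint \<mu> \<eta> n \<omega> t \<le> max 0 (Bd n) * D"
      unfolding Yint_def using bd[OF w] zero[OF w] by (intro int[rule_format] t) (auto simp: le_max_iff_disj)
  qed (use D in simp)
qed

lemma uniform_increments:
  fixes M :: "'w measure" and F :: "nat \<Rightarrow> 'w measure"
    and \<mu> :: "nat \<Rightarrow> 'w \<Rightarrow> real^'d \<Rightarrow> real"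
    and \<Gamma> :: "'g::metric_space set" and \<eta> :: "'g \<Rightarrow> (real^'d) measure"
    and \<alpha> s \<theta> \<gamma>0 C c :: real
  assumes SI: "SI_martingale M F \<mu>"
    and eta_borel: "\<forall>t\<in>\<Gamma>. sets (\<eta> t) = sets borel"
    and eta_finite: "\<forall>t\<in>\<Gamma>. finite_measure (\<eta> t)"
    and pos: "0 < \<alpha>" "0 < s" "0 < \<theta>" "0 < \<gamma>0" "0 < C"
    and H1: "\<forall>\<xi>>0. \<exists>C\<xi>. \<forall>r>0. \<exists>T. finite T \<and> T \<subseteq> \<Gamma> \<and>
               real (card T) \<le> exp (C\<xi> * r powr (-\<xi>)) \<and> \<Gamma> \<subseteq> (\<Union>t\<in>T. cball t r)"
    and H2: "\<forall>x t r. t \<in> \<Gamma> \<longrightarrow> 0 < r \<longrightarrow> r < 1 \<longrightarrow> measure (\<eta> t) (cball x r) \<le> C * r powr s"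
    and H3: "AE \<omega> in M. \<forall>n x. \<mu> n \<omega> x \<le> C * 2 powr (\<alpha> * real n)"
    and H4: "AE \<omega> in M. \<exists>N0. \<forall>t\<in>\<Gamma>. \<forall>u\<in>\<Gamma>. \<forall>n\<ge>N0. t \<noteq> u \<longrightarrow>
               \<bar>Yint \<mu> \<eta> n \<omega> t - Yint \<mu> \<eta> n \<omega> u\<bar> \<le> C * 2 powr (\<theta> * real n) * dist t u powr \<gamma>0"
    and c: "0 < c" "2 * c < s - \<alpha>"
  shows "AE \<omega> in M. \<exists>L n1. \<forall>n\<ge>n1. \<forall>t\<in>\<Gamma>.
           \<bar>Yint \<mu> \<eta> (Suc n) \<omega> t - Yint \<mu> \<eta> n \<omega> t\<bar> \<le> L * 2 powr (- c * real n)"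
proof -
  \<comment> \<open>Makes \<open>\<theta> - A * \<gamma>0 = - s\<close>, so by (H4) replacing
    \<open>t\<close> by a net point costs an error of order 2^(-sn), which is at most of order
    2^(-cn).\<close>
  define A where "A = (\<theta> + s) / \<gamma>0"
  have A: "0 < A" using pos by (simp add: A_def)
  obtain S where S: "\<forall>n. 0 \<le> S n \<and> (\<forall>\<omega>\<in>space M. \<forall>t\<in>\<Gamma>. 0 \<le> Yint \<mu> \<eta> n \<omega> t \<and> Yint \<mu> \<eta> n \<omega> t \<le> S n)"
    using Yint_bounded[OF SI less_imp_le[OF pos(5)] eta_borel eta_finite H2] by (rule exE)
  obtain T where T: "\<And>n. T n \<subseteq> \<Gamma>" "\<And>n. \<Gamma> \<subseteq> (\<Union>t\<in>T n. cball t (2 powr (- A * real n)))"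
    and net: "AE \<omega> in M. eventually (\<lambda>n. \<forall>t\<in>T n.
        \<bar>Yint \<mu> \<eta> (Suc n) \<omega> t - Yint \<mu> \<eta> n \<omega> t\<bar> \<le> 2 powr (- c * real n) * (1 + Yint \<mu> \<eta> n \<omega> t)) sequentially"
    by (rule increments_on_net[OF SI eta_borel eta_finite pos(5) H1 H2 H3 A c]) (rule that, assumption+)
  \<comment> \<open>The factor \<open>2 powr \<theta>\<close> covers the use of (H4) at time
    \<open>Suc n\<close> with the net of time \<open>n\<close>.\<close>
  define E where "E = C * 2 powr \<theta>"
  have E: "0 \<le> E" using pos by (simp add: E_def)
  show ?thesis
    using net H4 AE_space
  proof eventually_elim
    case (elim \<omega>)
    obtain N1 where N1: "\<And>n t. N1 \<le> n \<Longrightarrow> t \<in> T n \<Longrightarrow>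
        \<bar>Yint \<mu> \<eta> (Suc n) \<omega> t - Yint \<mu> \<eta> n \<omega> t\<bar> \<le> 2 powr (- c * real n) * (1 + Yint \<mu> \<eta> n \<omega> t)"
      using elim(1) unfolding eventually_sequentially by blast
    obtain N0 where N0: "\<And>t u n. t \<in> \<Gamma> \<Longrightarrow> u \<in> \<Gamma> \<Longrightarrow> N0 \<le> n \<Longrightarrow> t \<noteq> u \<Longrightarrow>
        \<bar>Yint \<mu> \<eta> n \<omega> t - Yint \<mu> \<eta> n \<omega> u\<bar> \<le> C * 2 powr (\<theta> * real n) * dist t u powr \<gamma>0"
      using elim(2) by blast
    define n1 where "n1 = max N0 N1"
    have "\<exists>L. \<forall>n\<ge>n1. \<forall>t\<in>\<Gamma>. \<bar>Yint \<mu> \<eta> (Suc n) \<omega> t - Yint \<mu> \<eta> n \<omega> t\<bar> \<le> L * 2 powr (- c * real n)"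
    \<comment> \<open>Of the three \<open>E\<close>, two come from moving to the net point at times
      \<open>n\<close> and \<open>Suc n\<close>, the third from replacing the integral at the net
      point by that at \<open>t\<close> inside the factor 1 + Y.\<close>
    proof (rule multiplicative_increments_geometric[OF c(1), where E = "1 + 3 * E" and D = "S n1"])
      show "0 \<le> 1 + 3 * E" using E by simp
      show "0 \<le> Yint \<mu> \<eta> n \<omega> t" if "t \<in> \<Gamma>" for n t using S elim(3) that by blast
      show "Yint \<mu> \<eta> n1 \<omega> t \<le> S n1" if "t \<in> \<Gamma>" for t using S elim(3) that by blast
    next
      fix n t assume n: "n1 \<le> n" and t: "t \<in> \<Gamma>"
      define \<kappa> where "\<kappa> = 2 powr (- c * real n)"
      have \<kappa>: "0 < \<kappa>" "\<kappa> \<le> 1"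
        using c powr_mono[of "- c * real n" 0 2] by (auto simp: \<kappa>_def)
      obtain u where u: "u \<in> T n" "dist u t \<le> 2 powr (- A * real n)" using T(2)[of n] t by auto
      have u\<Gamma>: "u \<in> \<Gamma>" using u T by auto
      have near: "\<bar>Yint \<mu> \<eta> m \<omega> t - Yint \<mu> \<eta> m \<omega> u\<bar> \<le> E * \<kappa>" if m: "n \<le> m" "m \<le> Suc n" for m
      proof (cases "t = u")
        case True
        then show ?thesis using E \<kappa> by simp
      next
        case False
        have "\<bar>Yint \<mu> \<eta> m \<omega> t - Yint \<mu> \<eta> m \<omega> u\<bar> \<le> C * 2 powr (\<theta> * real m) * dist t u powr \<gamma>0"
          using n m by (intro N0 t u\<Gamma> False) (simp add: n1_def)
        also have "\<dots> \<le> C * 2 powr (\<theta> * (real n + 1)) * (2 powr (- A * real n)) powr \<gamma>0"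
          using u(2) m pos by (intro mult_mono powr_mono2) (auto simp: dist_commute)
        also have "\<dots> = E * 2 powr (- s * real n)"
          using pos by (simp add: E_def A_def powr_powr powr_add[symmetric] mult.assoc) (simp add: field_simps)
        also have "\<dots> \<le> E * \<kappa>"
        proof -
          have "c \<le> s" using c pos by linarith
          then show ?thesis unfolding \<kappa>_def using E by (intro mult_left_mono powr_mono) (auto intro: mult_right_mono)
        qed
        finally show ?thesis .
      qed
      have Y0: "0 \<le> Yint \<mu> \<eta> n \<omega> t" using S elim(3) t by blast
      have "\<bar>Yint \<mu> \<eta> (Suc n) \<omega> u - Yint \<mu> \<eta> n \<omega> u\<bar> \<le> \<kappa> * (1 + Yint \<mu> \<eta> n \<omega> u)"
        unfolding \<kappa>_def using n u by (intro N1) (simp add: n1_def)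
      also have "\<dots> \<le> \<kappa> * (1 + (Yint \<mu> \<eta> n \<omega> t + E * \<kappa>))"
        using near[of n] \<kappa> by (intro mult_left_mono) auto
      also have "\<dots> \<le> \<kappa> * (1 + (Yint \<mu> \<eta> n \<omega> t + E))"
        using \<kappa> E by (intro mult_left_mono add_mono mult_left_le) auto
      finally have "\<bar>Yint \<mu> \<eta> (Suc n) \<omega> t - Yint \<mu> \<eta> n \<omega> t\<bar>
          \<le> \<kappa> * (1 + (Yint \<mu> \<eta> n \<omega> t + E)) + 2 * (E * \<kappa>)"
        using near[of n] near[of "Suc n"] by linarith
      also have "\<dots> \<le> (1 + 3 * E) * \<kappa> * (1 + Yint \<mu> \<eta> n \<omega> t)"
        using \<kappa> E Y0 by (simp add: algebra_simps)
      finally show "\<bar>Yint \<mu> \<eta> (Suc n) \<omega> t - Yint \<mu> \<eta> n \<omega> t\<bar>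
          \<le> (1 + 3 * E) * 2 powr (- c * real n) * (1 + Yint \<mu> \<eta> n \<omega> t)"
        by (simp add: \<kappa>_def)
    qed
    then show ?case by blast
  qed
qed

theorem theorem4p1:
  fixes M :: "'w measure" and F :: "nat \<Rightarrow> 'w measure"
    and \<mu> :: "nat \<Rightarrow> 'w \<Rightarrow> real^'d \<Rightarrow> real"
    and \<Gamma> :: "'g::metric_space set" and \<eta> :: "'g \<Rightarrow> (real^'d) measure"
    and \<alpha> s \<theta> \<gamma>0 C :: real
  assumes SI: "SI_martingale M F \<mu>"
    and eta_borel: "\<forall>t\<in>\<Gamma>. sets (\<eta> t) = sets borel"
    and eta_finite: "\<forall>t\<in>\<Gamma>. finite_measure (\<eta> t)"
    and pos: "0 < \<alpha>" "0 < s" "0 < \<theta>" "0 < \<gamma>0" "0 < C"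
    and H1: "\<forall>\<xi>>0. \<exists>C\<xi>. \<forall>r>0. \<exists>T. finite T \<and> T \<subseteq> \<Gamma> \<and>
               real (card T) \<le> exp (C\<xi> * r powr (-\<xi>)) \<and> \<Gamma> \<subseteq> (\<Union>t\<in>T. cball t r)"
    and H2: "\<forall>x t r. t \<in> \<Gamma> \<longrightarrow> 0 < r \<longrightarrow> r < 1 \<longrightarrow> measure (\<eta> t) (cball x r) \<le> C * r powr s"
    and H3: "AE \<omega> in M. \<forall>n x. \<mu> n \<omega> x \<le> C * 2 powr (\<alpha> * real n)"
    and H4: "AE \<omega> in M. \<exists>N0. \<forall>t\<in>\<Gamma>. \<forall>u\<in>\<Gamma>. \<forall>n\<ge>N0. t \<noteq> u \<longrightarrow>
               \<bar>Yint \<mu> \<eta> n \<omega> t - Yint \<mu> \<eta> n \<omega> u\<bar> \<le> C * 2 powr (\<theta> * real n) * dist t u powr \<gamma>0"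
    and s_gt: "s > \<alpha>"
  shows "\<exists>c>0. AE \<omega> in M. \<exists>Y :: 'g \<Rightarrow> real. \<exists>K.
           (\<forall>n. \<forall>t\<in>\<Gamma>. \<bar>Yint \<mu> \<eta> n \<omega> t - Y t\<bar> \<le> K * 2 powr (- c * real n)) \<and>
           (\<forall>\<gamma>. 0 < \<gamma> \<and> \<gamma> < (s - \<alpha>) * \<gamma>0 / (s - \<alpha> + 2 * \<theta>) \<longrightarrow>
              (\<exists>H. \<forall>t\<in>\<Gamma>. \<forall>u\<in>\<Gamma>. \<bar>Y t - Y u\<bar> \<le> H * dist t u powr \<gamma>))"
proof -
  \<comment> \<open>\<open>c 0\<close>, a quarter of \<open>s - \<alpha>\<close>, becomes the rate
    of convergence; the later rates give the Hoelder exponents close to the critical one.\<close>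
  define c where "c m = (s - \<alpha>) / 2 * (1 - 1 / (real m + 2))" for m :: nat
  have c: "0 < c m" "2 * c m < s - \<alpha>" for m
  proof -
    have "0 < 1 - 1 / (real m + 2)" "1 - 1 / (real m + 2) < 1" by auto
    then show "0 < c m" "2 * c m < s - \<alpha>" using s_gt by (simp_all add: c_def)
  qed
  obtain S where S: "\<forall>n. 0 \<le> S n \<and> (\<forall>\<omega>\<in>space M. \<forall>t\<in>\<Gamma>. 0 \<le> Yint \<mu> \<eta> n \<omega> t \<and> Yint \<mu> \<eta> n \<omega> t \<le> S n)"
    using Yint_bounded[OF SI less_imp_le[OF pos(5)] eta_borel eta_finite H2] by (rule exE)
  have "AE \<omega> in M. \<forall>m. \<exists>L n1. \<forall>n\<ge>n1. \<forall>t\<in>\<Gamma>.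
           \<bar>Yint \<mu> \<eta> (Suc n) \<omega> t - Yint \<mu> \<eta> n \<omega> t\<bar> \<le> L * 2 powr (- c m * real n)"
    unfolding AE_all_countable
    by (intro allI uniform_increments[OF SI eta_borel eta_finite pos H1 H2 H3 H4 c])
  then have "AE \<omega> in M. \<exists>Y :: 'g \<Rightarrow> real. \<exists>K.
           (\<forall>n. \<forall>t\<in>\<Gamma>. \<bar>Yint \<mu> \<eta> n \<omega> t - Y t\<bar> \<le> K * 2 powr (- c 0 * real n)) \<and>
           (\<forall>\<gamma>. 0 < \<gamma> \<and> \<gamma> < (s - \<alpha>) * \<gamma>0 / (s - \<alpha> + 2 * \<theta>) \<longrightarrow>
              (\<exists>H. \<forall>t\<in>\<Gamma>. \<forall>u\<in>\<Gamma>. \<bar>Y t - Y u\<bar> \<le> H * dist t u powr \<gamma>))"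
    using H4 AE_space
  proof eventually_elim
    case (elim \<omega>)
    define y where "y n t = Yint \<mu> \<eta> n \<omega> t" for n t
    \<comment> \<open>The limit does not refer to \<open>m\<close>, so all rates concern the same
      function.\<close>
    define Y where "Y t = lim (\<lambda>n. y n t)" for t
    have y: "0 \<le> y n t" "y n t \<le> S n" if "t \<in> \<Gamma>" for n t
      using S elim(3) that unfolding y_def by blast+
    obtain N0 where N0: "\<And>t u n. t \<in> \<Gamma> \<Longrightarrow> u \<in> \<Gamma> \<Longrightarrow> N0 \<le> n \<Longrightarrow> t \<noteq> u \<Longrightarrow>
        \<bar>y n t - y n u\<bar> \<le> C * 2 powr (\<theta> * real n) * dist t u powr \<gamma>0"
      using elim(2) unfolding y_def by blast
    have rate: "\<exists>L n1. 0 \<le> L \<and> (\<forall>n\<ge>n1. \<forall>t\<in>\<Gamma>. \<bar>y n t - Y t\<bar> \<le> L * 2 powr (- c m * real n))" for m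
    proof -
      obtain L n1 where L: "\<And>n t. n1 \<le> n \<Longrightarrow> t \<in> \<Gamma> \<Longrightarrow> \<bar>y (Suc n) t - y n t\<bar> \<le> L * 2 powr (- c m * real n)"
        using elim(1) unfolding y_def by blast
      have L': "\<bar>y (Suc n) t - y n t\<bar> \<le> \<bar>L\<bar> * 2 powr (- c m * real n)" if "n1 \<le> n" "t \<in> \<Gamma>" for n t
        by (rule order_trans[OF L[OF that]], rule mult_right_mono) auto
      have "\<bar>y n t - Y t\<bar> \<le> \<bar>L\<bar> / (1 - 2 powr - c m) * 2 powr (- c m * real n)" if "n1 \<le> n" "t \<in> \<Gamma>" for n t
        unfolding Y_def
        using geometric_increments_limit[OF c(1), of n1 "\<lambda>n. y n t" "\<bar>L\<bar>" m n] L' that by blast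
      moreover have "0 \<le> \<bar>L\<bar> / (1 - 2 powr - c m)"
        using powr_minus_less_one[OF c(1), of m] by simp
      ultimately show ?thesis by blast
    qed
    obtain L n1 where L: "0 \<le> L"
      "\<And>n t. n1 \<le> n \<Longrightarrow> t \<in> \<Gamma> \<Longrightarrow> \<bar>y n t - Y t\<bar> \<le> L * 2 powr (- c 0 * real n)"
      using rate[of 0] by blast
    have Y_le: "\<bar>Y t\<bar> \<le> S n1 + L" if t: "t \<in> \<Gamma>" for t
    proof -
      have "2 powr (- c 0 * real n1) \<le> 2 powr 0"
        using c(1)[of 0] by (intro powr_mono) auto
      then have "L * 2 powr (- c 0 * real n1) \<le> L * 1" using L(1) by (intro mult_left_mono) auto
      then show ?thesis using L(2)[OF order_refl t] y[OF t, of n1] by simp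
    qed
    \<comment> \<open>Before \<open>n1\<close> the error is at most \<open>S n + (S n1 + L)\<close>.
      The sum undoes the decaying factor at each of these finitely many indices, so the estimate
      holds from \<open>n = 0\<close> on.\<close>
    define K where "K = L + (\<Sum>n<n1. (S n + (S n1 + L)) * 2 powr (c 0 * real n))"
    have S0: "0 \<le> S n" for n using S by blast
    have "\<bar>y n t - Y t\<bar> \<le> K * 2 powr (- c 0 * real n)" if t: "t \<in> \<Gamma>" for n t
    proof (cases "n1 \<le> n")
      case True
      have "L \<le> K" unfolding K_def using S0 L(1) by (simp add: sum_nonneg)
      then have "L * 2 powr (- c 0 * real n) \<le> K * 2 powr (- c 0 * real n)" by (intro mult_right_mono) auto
      then show ?thesis using L(2)[OF True t] by linarith
    next
      case False
      have "(S n + (S n1 + L)) * 2 powr (c 0 * real n) \<le> (\<Sum>n<n1. (S n + (S n1 + L)) * 2 powr (c 0 * real n))"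
        using False S0 L(1) by (intro member_le_sum) auto
      then have "(S n + (S n1 + L)) * 2 powr (c 0 * real n) \<le> K" using L(1) by (simp add: K_def)
      then have "(S n + (S n1 + L)) * 2 powr (c 0 * real n) * 2 powr (- c 0 * real n) \<le> K * 2 powr (- c 0 * real n)"
        by (intro mult_right_mono) auto
      moreover have "2 powr (c 0 * real n) * 2 powr (- c 0 * real n) = 1"
        by (simp add: powr_add[symmetric])
      ultimately have "S n + (S n1 + L) \<le> K * 2 powr (- c 0 * real n)"
        by (simp only: mult.assoc mult_1_right)
      then show ?thesis using y[OF t, of n] Y_le[OF t] by linarith
    qed
    moreover have "\<exists>H. \<forall>t\<in>\<Gamma>. \<forall>u\<in>\<Gamma>. \<bar>Y t - Y u\<bar> \<le> H * dist t u powr \<gamma>"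
      if \<gamma>: "0 < \<gamma>" "\<gamma> < (s - \<alpha>) * \<gamma>0 / (s - \<alpha> + 2 * \<theta>)" for \<gamma>
    proof -
      obtain m where m: "\<gamma> \<le> c m * \<gamma>0 / (\<theta> + c m)"
        using holder_exponent_exhausted[of "s - \<alpha>" \<theta> \<gamma> \<gamma>0] \<gamma>(2) s_gt pos unfolding c_def by auto
      obtain L' n' where L': "0 \<le> L'"
        "\<And>n t. n' \<le> n \<Longrightarrow> t \<in> \<Gamma> \<Longrightarrow> \<bar>y n t - Y t\<bar> \<le> L' * 2 powr (- c m * real n)"
        using rate[of m] by blast
      \<comment> \<open>\<open>2 * L'\<close> pays for replacing both limits by their values at time
        \<open>n\<close>; \<open>2 * (S n1 + L)\<close> bounds every difference of limits, whatever
        the distance.\<close>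
      have "0 \<le> 2 * L'" "0 \<le> C" "0 \<le> 2 * (S n1 + L)" using L' pos S0 L by auto
      from holder_interpolation[OF c(1) pos(3,4) \<gamma>(1) m this, of "max N0 n'"]
      obtain H where H: "\<And>d x. 0 < d \<Longrightarrow> x \<le> 2 * (S n1 + L) \<Longrightarrow>
          (\<And>n. max N0 n' \<le> n \<Longrightarrow> x \<le> 2 * L' * 2 powr (- c m * real n) + C * 2 powr (\<theta> * real n) * d powr \<gamma>0)
          \<Longrightarrow> x \<le> H * d powr \<gamma>"
        by blast
      have "\<bar>Y t - Y u\<bar> \<le> H * dist t u powr \<gamma>" if t: "t \<in> \<Gamma>" and u: "u \<in> \<Gamma>" for t u
      proof (cases "t = u")
        case False
        show ?thesis
        proof (rule H)
          show "0 < dist t u" using False by simp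
          show "\<bar>Y t - Y u\<bar> \<le> 2 * (S n1 + L)" using Y_le[OF t] Y_le[OF u] abs_triangle_ineq4[of "Y t" "Y u"] by simp
          show "\<bar>Y t - Y u\<bar> \<le> 2 * L' * 2 powr (- c m * real n) + C * 2 powr (\<theta> * real n) * dist t u powr \<gamma>0"
            if n: "max N0 n' \<le> n" for n
            using L'(2)[of n t] L'(2)[of n u] N0[OF t u _ False, of n] n t u by simp
        qed
      qed simp
      then show ?thesis by blast
    qed
    ultimately show ?case unfolding y_def by blast
  qed
  with c(1)[of 0] show ?thesis by blast
qed

end
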